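(* Assume $\mathbb{E}(\omega_e^2+\nu_v^2)<\infty$. Then there exist $m\in\mathbb{R}$ and $\sigma_M\in[0,\infty)$ such that, as $n\to\infty$, $$n^{-1}M_n\to m\ \text{ in probability}\qquad\text{and}\qquad n^{-1}\operatorname{Var}(M_n)\to\sigma_M^2 .$$ Moreover, if $\mathbb{E}(|\omega_e|^{2+\varepsilon}+|\nu_v|^{2+\varepsilon})<\infty$ for some $\varepsilon>0$, then $$n^{-1/2}\,(M_n-\mathbb{E}M_n)\to N(0,\sigma_M^2)\quad\text{in distribution}.$$
   Context: Let $H=(V_H,E_H)$ be a fixed finite graph with $|V_H|=h\ge 1$, and let $G_n$ be the line graph (path) on the $n$ vertices $1,\dots,n$ with $i\sim i+1$. The cylinder graph $\mathcal{G}_n=G_n\times H$ is the Cartesian product: its vertex set is $V=\{1,\dots,n\}\times V_H$, and $(i,j)\sim(i',j')$ iff either $i\sim i'$ in $G_n$ and $j=j'$, or $i=i'$ and $j\sim j'$ in $H$. Let $E$ be its edge set. The vertex weights $\{\nu_v\}_{v\in V}$ are i.i.d. real random variables; the edge weights $\{\omega_e\}_{e\in E}$ are i.i.d. real random variables, independent of the vertex weights, possibly with a different law; the two laws do not depend on $n$. A matching $\mathfrak{m}\subseteq E$ is a (possibly empty) set of pairwise vertex-disjoint edges; $\mathcal{M}$ is the set of all matchings of $\mathcal{G}_n$; $v\notin\mathfrak{m}$ means that $v$ is not covered by any edge of $\mathfrak{m}$. The Hamiltonian is $\mathcal{H}(\mathfrak{m})=\sum_{v\notin\mathfrak{m}}\nu_v+\sum_{e\in\mathfrak{m}}\omega_e$.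 The ground state energy is $M_n=\max_{\mathfrak{m}\in\mathcal{M}}\mathcal{H}(\mathfrak{m})$. $N(0,0)$ is the Dirac mass at $0$. *)

theory Defs
  imports "HOL-Probability.Probability"
begin

definition finite_graph :: "'v set \<Rightarrow> 'v set set \<Rightarrow> bool" where
  "finite_graph V E \<longleftrightarrow> finite V \<and> (\<forall>e\<in>E. e \<subseteq> V \<and> card e = 2)"

definition path_vertices :: "nat \<Rightarrow> nat set" where
  "path_vertices n = {1..n}"

definition path_edges :: "nat \<Rightarrow> nat set set" where
  "path_edges n = {{i, i + 1} | i. 1 \<le> i \<and> i < n}"

(* For loopless factors the result is loopless: {i, i'} and {j, j'} below can only be edges
   if i and i', respectively j and j', are distinct. *)
definition cartesian_edges ::
  "'a set \<Rightarrow> 'a set set \<Rightarrow> 'b set \<Rightarrow> 'b set set \<Rightarrow> ('a \<times> 'b) set set" where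
  "cartesian_edges V1 E1 V2 E2 =
     {{(i, j), (i', j')} | i j i' j'.
        i \<in> V1 \<and> i' \<in> V1 \<and> j \<in> V2 \<and> j' \<in> V2 \<and>
        ({i, i'} \<in> E1 \<and> j = j' \<or> i = i' \<and> {j, j'} \<in> E2)}"

definition cylinder_vertices :: "'h set \<Rightarrow> nat \<Rightarrow> (nat \<times> 'h) set" where
  "cylinder_vertices VH n = path_vertices n \<times> VH"

definition cylinder_edges :: "'h set \<Rightarrow> 'h set set \<Rightarrow> nat \<Rightarrow> (nat \<times> 'h) set set" where
  "cylinder_edges VH EH n = cartesian_edges (path_vertices n) (path_edges n) VH EH"

definition matchings :: "'v set set \<Rightarrow> 'v set set set" where
  "matchings E = {m. m \<subseteq> E \<and> pairwise disjnt m}"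

definition hamiltonian ::
  "'v set \<Rightarrow> ('v \<Rightarrow> real) \<Rightarrow> ('v set \<Rightarrow> real) \<Rightarrow> 'v set set \<Rightarrow> real" where
  "hamiltonian V \<nu> \<omega> m = (\<Sum>v\<in>V - \<Union>m. \<nu> v) + (\<Sum>e\<in>m. \<omega> e)"

definition ground_state_energy ::
  "'v set \<Rightarrow> 'v set set \<Rightarrow> ('v \<Rightarrow> real) \<Rightarrow> ('v set \<Rightarrow> real) \<Rightarrow> real" where
  "ground_state_energy V E \<nu> \<omega> = Max (hamiltonian V \<nu> \<omega> ` matchings E)"

(* The variables X n may live on different probability spaces P n, which is meaningful
   because the limit c is a constant. *)
definition converges_in_probability_const ::
  "(nat \<Rightarrow> 'a measure) \<Rightarrow> (nat \<Rightarrow> 'a \<Rightarrow> real) \<Rightarrow> real \<Rightarrow> bool" where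
  "converges_in_probability_const P X c \<longleftrightarrow>
     (\<forall>\<epsilon>>0. (\<lambda>n. measure (P n) {x \<in> space (P n). \<bar>X n x - c\<bar> > \<epsilon>}) \<longlonglongrightarrow> 0)"

(* The second parameter is the standard deviation, as in normal_density. The case s = 0 is
   separate because normal_density a 0 is identically 0. *)
definition normal_law :: "real \<Rightarrow> real \<Rightarrow> real measure" where
  "normal_law a s =
     (if s = 0 then return borel a else density lborel (\<lambda>x. ennreal (normal_density a s x)))"

end

theory Submission
  imports Defs
begin

text \<open>
  Cutting the cylinder between two columns changes the ground state energy by at most the total
  absolute weight near the cut, so the energies \<open>W a l\<close> of the slabs of columns \<open>a + 1, \<dots>, a + l\<close>
  are additive up to an error bounded in \<open>L\<^sup>2\<close>, while disjoint slabs are independent. Split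
  \<open>n = k L\<close> columns into \<open>k\<close> blocks by repeated halving: the errors made at one level of the halving
  are independent, so together all of them have standard deviation \<open>O(\<surd>k)\<close>, not merely \<open>O(k)\<close>. Hence
  \<open>M\<^sub>n / \<surd>n\<close> is, after centering, within \<open>O(1 / \<surd>L)\<close> in \<open>L\<^sup>2\<close> of a normalized sum of \<open>k\<close>
  i.i.d. block energies, uniformly in \<open>n\<close>. Letting \<open>n\<close> and then \<open>L\<close> tend to infinity gives the limit of
  the variance and, through characteristic functions, the central limit theorem.
\<close>

section \<open>Square integrable random variables\<close>

text \<open>A defect is small because it is controlled by the weights next to its cut, but it is a
  function of all weights of the two slabs that the cut separates. Cutting off one block after
  another therefore produces dependent defects whose variances do not add. Halving arranges the cuts
  so that those of one level live on disjoint windows; different levels are combined by the triangle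
  inequality only. With 2^j cuts at level j the contributions are of order C 2^(j/2), a geometric
  series dominated by its last term, hence O(sqrt k). In the proof this becomes the recursion s(k)
  <= sqrt (s(p)^2 + s(q)^2) + C with k = p + q. Means need no such care: an error C k is harmless
  after division by n.

  The variables for different n may live on unrelated spaces, but each claim concerns only the law
  of one energy. All slab energies are therefore realised on a single product space carrying a
  weight for every conceivable vertex and edge, where translation of columns is a reindexing of
  coordinates.\<close>

context prob_space
begin

definition L2 :: "('a \<Rightarrow> real) set" where
  "L2 = {X \<in> borel_measurable M. integrable M (\<lambda>x. (X x)\<^sup>2)}"

text \<open>A seminorm on \<open>L2\<close> that vanishes on constants. It is preferred to the
  variance because it satisfies the triangle inequality, while its square still adds over
  independent summands; the estimates alternate between the two properties.\<close>

definition std_dev :: "('a \<Rightarrow> real) \<Rightarrow> real" where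
  "std_dev X = sqrt (variance X)"

lemma L2_measurable: "X \<in> L2 \<Longrightarrow> X \<in> borel_measurable M"
  by (simp add: L2_def)

lemma L2_integrable_square: "X \<in> L2 \<Longrightarrow> integrable M (\<lambda>x. (X x)\<^sup>2)"
  by (simp add: L2_def)

lemma L2_integrable: "X \<in> L2 \<Longrightarrow> integrable M X"
  by (auto simp: L2_def intro: square_integrable_imp_integrable)

lemma L2_const: "(\<lambda>_. c) \<in> L2"
  by (simp add: L2_def)

lemma L2_dominated:
  assumes "Y \<in> L2" "X \<in> borel_measurable M" "\<And>x. \<bar>X x\<bar> \<le> \<bar>Y x\<bar>"
  shows "X \<in> L2"
proof -
  have "integrable M (\<lambda>x. (X x)\<^sup>2)"
    by (rule Bochner_Integration.integrable_bound[OF L2_integrable_square[OF assms(1)]])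
       (use assms in \<open>auto simp: abs_le_square_iff\<close>)
  then show ?thesis using assms(2) by (simp add: L2_def)
qed

lemma L2_integrable_mult:
  assumes "X \<in> L2" "Y \<in> L2"
  shows "integrable M (\<lambda>x. X x * Y x)"
proof (rule Bochner_Integration.integrable_bound)
  show "integrable M (\<lambda>x. (X x)\<^sup>2 + (Y x)\<^sup>2)"
    using assms by (auto simp: L2_def)
  show "(\<lambda>x. X x * Y x) \<in> borel_measurable M"
    using assms by (auto simp: L2_def)
  have "\<bar>a * b\<bar> \<le> a\<^sup>2 + b\<^sup>2" for a b :: real
    using sum_squares_bound[of a b] sum_squares_bound[of a "-b"] by (auto simp: abs_if)
  then show "AE x in M. norm (X x * Y x) \<le> norm ((X x)\<^sup>2 + (Y x)\<^sup>2)"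
    by auto
qed

lemma L2_add:
  assumes "X \<in> L2" "Y \<in> L2"
  shows "(\<lambda>x. X x + Y x) \<in> L2"
  using assms L2_integrable_mult[OF assms] by (auto simp: L2_def power2_sum mult.assoc)

lemma L2_cmult: "X \<in> L2 \<Longrightarrow> (\<lambda>x. c * X x) \<in> L2"
  by (auto simp: L2_def power_mult_distrib)

lemma L2_uminus: "X \<in> L2 \<Longrightarrow> (\<lambda>x. - X x) \<in> L2"
  by (auto simp: L2_def)

lemma L2_diff: "X \<in> L2 \<Longrightarrow> Y \<in> L2 \<Longrightarrow> (\<lambda>x. X x - Y x) \<in> L2"
  using L2_add[of X "\<lambda>x. - Y x"] L2_uminus[of Y] by simp

lemma L2_divide: "X \<in> L2 \<Longrightarrow> (\<lambda>x. X x / c) \<in> L2"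
  using L2_cmult[of X "1 / c"] by simp

lemma L2_sum: "(\<And>i. i \<in> I \<Longrightarrow> X i \<in> L2) \<Longrightarrow> (\<lambda>x. \<Sum>i\<in>I. X i x) \<in> L2"
  by (induction I rule: infinite_finite_induct) (auto intro: L2_add L2_const)

lemmas L2_intros = L2_const L2_add L2_cmult L2_diff L2_uminus L2_divide L2_sum

text \<open>Cauchy-Schwarz by the discriminant: the second moment of t X + Y is a quadratic
  polynomial in t without negative values.\<close>

lemma expectation_mult_le:
  assumes "X \<in> L2" "Y \<in> L2"
  shows "(expectation (\<lambda>x. X x * Y x))\<^sup>2 \<le> expectation (\<lambda>x. (X x)\<^sup>2) * expectation (\<lambda>x. (Y x)\<^sup>2)"
proof -
  define a b c where "a = expectation (\<lambda>x. (X x)\<^sup>2)"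
    and "b = expectation (\<lambda>x. X x * Y x)" and "c = expectation (\<lambda>x. (Y x)\<^sup>2)"
  have *: "0 \<le> a * t\<^sup>2 + 2 * b * t + c" for t
  proof -
    have "0 \<le> expectation (\<lambda>x. (t * X x + Y x)\<^sup>2)" by simp
    also have "\<dots> = expectation (\<lambda>x. t\<^sup>2 * (X x)\<^sup>2 + (2 * t) * (X x * Y x) + (Y x)\<^sup>2)"
      by (intro arg_cong[where f = expectation]) (auto simp: fun_eq_iff power2_eq_square algebra_simps)
    also have "\<dots> = t\<^sup>2 * a + (2 * t) * b + c"
      using assms L2_integrable_mult[OF assms] by (simp add: L2_def a_def b_def c_def)
    finally show ?thesis by (simp add: algebra_simps)
  qed
  have a: "0 \<le> a" by (simp add: a_def)
  show "b\<^sup>2 \<le> a * c"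
  proof (cases "a = 0")
    case True
    have "b = 0"
    proof (rule ccontr)
      assume "b \<noteq> 0"
      \<comment> \<open>The polynomial is now linear, 2 b t + c, and takes the value -1 at this
        t.\<close>
      then show False using *[of "- (c + 1) / (2 * b)"] True by (simp add: field_simps)
    qed
    then show ?thesis using True by simp
  next
    case False
    \<comment> \<open>The minimiser t = -b / a of the quadratic.\<close>
    then have "0 \<le> a * (a * (- b / a)\<^sup>2 + 2 * b * (- b / a) + c)"
      using *[of "- b / a"] a by (intro mult_nonneg_nonneg) auto
    also have "\<dots> = a * c - b\<^sup>2" using False by (simp add: field_simps power2_eq_square)
    finally show ?thesis by simp
  qed
qed

lemma variance_add_expand:
  assumes "X \<in> L2" "Y \<in> L2"
  shows "variance (\<lambda>x. X x + Y x) = variance X + variance Y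
    + 2 * expectation (\<lambda>x. (X x - expectation X) * (Y x - expectation Y))"
proof -
  note L2_integrable[OF assms(1), simp] L2_integrable[OF assms(2), simp]
  let ?U = "\<lambda>x. X x - expectation X" and ?V = "\<lambda>x. Y x - expectation Y"
  have L: "?U \<in> L2" "?V \<in> L2" by (intro L2_intros assms)+
  have "variance (\<lambda>x. X x + Y x) = expectation (\<lambda>x. (?U x)\<^sup>2 + (?V x)\<^sup>2 + 2 * (?U x * ?V x))"
    by (intro Bochner_Integration.integral_cong) (auto simp: power2_eq_square algebra_simps)
  also have "\<dots> = variance X + variance Y + 2 * expectation (\<lambda>x. ?U x * ?V x)"
    using L L2_integrable_mult[OF L] by (simp add: L2_def)
  finally show ?thesis .
qed

lemma std_dev_nonneg [simp]: "0 \<le> std_dev X"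
  by (simp add: std_dev_def)

lemma std_dev_square: "(std_dev X)\<^sup>2 = variance X"
  by (simp add: std_dev_def)

lemma std_dev_const [simp]: "std_dev (\<lambda>_. c) = 0"
  by (simp add: std_dev_def prob_space)

lemma std_dev_add_le:
  assumes "X \<in> L2" "Y \<in> L2"
  shows "std_dev (\<lambda>x. X x + Y x) \<le> std_dev X + std_dev Y"
proof -
  let ?U = "\<lambda>x. X x - expectation X" and ?V = "\<lambda>x. Y x - expectation Y"
  have L: "?U \<in> L2" "?V \<in> L2" by (intro L2_intros assms)+
  have "expectation (\<lambda>x. ?U x * ?V x) \<le> sqrt ((expectation (\<lambda>x. ?U x * ?V x))\<^sup>2)"
    by simp
  also have "\<dots> \<le> sqrt (variance X * variance Y)"
    by (intro real_sqrt_le_mono expectation_mult_le L)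
  also have "\<dots> = std_dev X * std_dev Y"
    by (simp add: std_dev_def real_sqrt_mult)
  finally have "variance (\<lambda>x. X x + Y x) \<le> (std_dev X + std_dev Y)\<^sup>2"
    unfolding variance_add_expand[OF assms] power2_sum std_dev_square by simp
  then show ?thesis
    unfolding std_dev_def[of "\<lambda>x. X x + Y x"]
    by (intro real_le_lsqrt) (auto intro!: add_nonneg_nonneg)
qed

lemma std_dev_cmult:
  assumes "X \<in> L2"
  shows "std_dev (\<lambda>x. c * X x) = \<bar>c\<bar> * std_dev X"
  using L2_integrable[OF assms]
  by (simp add: std_dev_def right_diff_distrib[symmetric] power_mult_distrib real_sqrt_mult)

lemma std_dev_divide:
  assumes "X \<in> L2"
  shows "std_dev (\<lambda>x. X x / c) = std_dev X / \<bar>c\<bar>"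
  using std_dev_cmult[OF assms, of "1 / c"] by simp

lemma std_dev_uminus: "std_dev (\<lambda>x. - X x) = std_dev X"
proof -
  have "(- X x - expectation (\<lambda>x. - X x))\<^sup>2 = (X x - expectation X)\<^sup>2" for x
    by (simp add: power2_eq_square algebra_simps)
  then show ?thesis by (simp add: std_dev_def)
qed

lemma std_dev_diff_le:
  assumes "X \<in> L2" "Y \<in> L2"
  shows "std_dev (\<lambda>x. X x - Y x) \<le> std_dev X + std_dev Y"
  using std_dev_add_le[OF assms(1) L2_uminus[OF assms(2)]] std_dev_uminus[of Y] by simp

lemma std_dev_dist_le:
  assumes "X \<in> L2" "Y \<in> L2"
  shows "\<bar>std_dev X - std_dev Y\<bar> \<le> std_dev (\<lambda>x. X x - Y x)"
proof -
  have "std_dev (\<lambda>x. (X x - Y x) + Y x) \<le> std_dev (\<lambda>x. X x - Y x) + std_dev Y"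
    by (intro std_dev_add_le L2_intros assms)
  moreover have "std_dev (\<lambda>x. X x - (X x - Y x)) \<le> std_dev X + std_dev (\<lambda>x. X x - Y x)"
    by (intro std_dev_diff_le L2_intros assms)
  ultimately show ?thesis by simp
qed

lemma std_dev_le_second_moment:
  assumes "X \<in> L2"
  shows "std_dev X \<le> sqrt (expectation (\<lambda>x. (X x)\<^sup>2))"
  unfolding std_dev_def using assms L2_integrable[OF assms]
  by (intro real_sqrt_le_mono) (simp add: variance_eq L2_def)

lemma expectation_abs_le_second_moment:
  assumes "X \<in> L2"
  shows "expectation (\<lambda>x. \<bar>X x\<bar>) \<le> sqrt (expectation (\<lambda>x. (X x)\<^sup>2))"
  using expectation_mult_le[OF L2_dominated[OF assms, of "\<lambda>x. \<bar>X x\<bar>"] L2_const[of 1]] assms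
  by (intro real_le_rsqrt) (auto simp: prob_space L2_def)

section \<open>Independent sums, and stability of characteristic functions\<close>

lemma variance_add_indep:
  assumes "X \<in> L2" "Y \<in> L2" "indep_var borel X borel Y"
  shows "variance (\<lambda>x. X x + Y x) = variance X + variance Y"
proof -
  let ?U = "\<lambda>x. X x - expectation X" and ?V = "\<lambda>x. Y x - expectation Y"
  have I: "indep_var borel ((\<lambda>t. t - expectation X) \<circ> X) borel ((\<lambda>t. t - expectation Y) \<circ> Y)"
    by (intro indep_var_compose[OF assms(3)]) auto
  have L: "integrable M ?U" "integrable M ?V" 
    by (intro L2_integrable L2_intros assms)+
  have "expectation (\<lambda>x. ?U x * ?V x) = expectation ?U * expectation ?V"
    using indep_var_lebesgue_integral[OF I] L by (simp add: comp_def)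
  also have "\<dots> = 0"
    using L2_integrable[OF assms(1)] by (simp add: prob_space)
  finally show ?thesis unfolding variance_add_expand[OF assms(1,2)] by simp
qed

lemma variance_sum_indep:
  assumes "finite I" "\<And>i. i \<in> I \<Longrightarrow> X i \<in> L2" "indep_vars (\<lambda>_. borel) X I"
  shows "variance (\<lambda>x. \<Sum>i\<in>I. X i x) = (\<Sum>i\<in>I. variance (X i))"
  using assms
proof (induction I rule: finite_induct)
  case (insert i I)
  have "variance (\<lambda>x. X i x + (\<Sum>i\<in>I. X i x)) = variance (X i) + variance (\<lambda>x. \<Sum>i\<in>I. X i x)"
    using insert by (intro variance_add_indep indep_vars_sum L2_sum) auto
  then show ?case
    using insert indep_vars_subset[OF insert.prems(2), of I] by auto
qed (simp add: prob_space)

text \<open>\<open>iexp\<close> is 1-Lipschitz, so the difference is at most |t| times the mean of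
  |X - Y|, which the second moment of X - Y controls. Equal means turn that second moment into a
  variance; this is how \<open>L2\<close> approximation enters the central limit theorem.\<close>

lemma norm_char_diff_le:
  assumes "X \<in> L2" "Y \<in> L2" and "expectation X = expectation Y"
  shows "norm (char (distr M borel X) t - char (distr M borel Y) t) \<le> \<bar>t\<bar> * std_dev (\<lambda>x. X x - Y x)"
proof -
  note [measurable] = L2_measurable[OF assms(1)] L2_measurable[OF assms(2)]
  have D: "(\<lambda>x. X x - Y x) \<in> L2" by (intro L2_intros assms)
  have int: "complex_integrable M (\<lambda>x. iexp (t * Z x))" if [measurable]: "Z \<in> borel_measurable M" for Z
    by (rule integrable_const_bound[where B = 1]) auto
  have "norm (iexp u - iexp v) \<le> \<bar>u - v\<bar>" for u v :: real
  proof -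
    have "iexp u - iexp v = iexp v * (iexp (u - v) - 1)"
      by (simp add: algebra_simps flip: exp_add)
    then show ?thesis
      using iexp_approx1[of "u - v" 0] by (simp add: norm_mult)
  qed
  note le = this
  have "char (distr M borel X) t - char (distr M borel Y) t
    = expectation (\<lambda>x. iexp (t * X x) - iexp (t * Y x))"
    by (subst Bochner_Integration.integral_diff[OF int int]) (auto simp: char_def integral_distr)
  also have "norm \<dots> \<le> expectation (\<lambda>x. norm (iexp (t * X x) - iexp (t * Y x)))"
    by (rule integral_norm_bound)
  also have "\<dots> \<le> expectation (\<lambda>x. \<bar>t\<bar> * \<bar>X x - Y x\<bar>)"
  proof (rule integral_mono)
    show "integrable M (\<lambda>x. norm (iexp (t * X x) - iexp (t * Y x)))"
      by (intro integrable_norm Bochner_Integration.integrable_diff int) auto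
    show "integrable M (\<lambda>x. \<bar>t\<bar> * \<bar>X x - Y x\<bar>)"
      using L2_integrable[OF D] by auto
    show "norm (iexp (t * X x) - iexp (t * Y x)) \<le> \<bar>t\<bar> * \<bar>X x - Y x\<bar>" for x
      using le[of "t * X x" "t * Y x"] by (simp add: abs_mult flip: right_diff_distrib)
  qed
  also have "\<dots> = \<bar>t\<bar> * expectation (\<lambda>x. \<bar>X x - Y x\<bar>)" by simp
  also have "\<dots> \<le> \<bar>t\<bar> * sqrt (expectation (\<lambda>x. (X x - Y x)\<^sup>2))"
    by (intro mult_left_mono expectation_abs_le_second_moment D) auto
  also have "expectation (\<lambda>x. (X x - Y x)\<^sup>2) = variance (\<lambda>x. X x - Y x)"
    using assms(3) L2_integrable[OF assms(1)] L2_integrable[OF assms(2)] by simp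
  finally show ?thesis by (simp add: std_dev_def)
qed

end

section \<open>Products of real probability measures\<close>

text \<open>The map \<open>col\<close> attaches a column to every coordinate, so that independence
  of two functions can be read off from disjoint sets of column numbers.\<close>

locale real_product_space =
  fixes N :: "'s \<Rightarrow> real measure" and col :: "'s \<Rightarrow> nat"
  assumes prob_N: "\<And>s. prob_space (N s)"
    and sets_N [measurable_cong, simp]: "\<And>s. sets (N s) = sets borel"
begin

abbreviation Q :: "('s \<Rightarrow> real) measure" where
  "Q \<equiv> Pi\<^sub>M UNIV N"

sublocale prob_space Q
  by (intro prob_space_PiM prob_N)

lemma space_N [simp]: "space (N s) = UNIV"
  using sets_eq_imp_space_eq[OF sets_N[of s]] by simp

lemma space_Q [simp]: "space Q = UNIV"
  by (simp add: space_PiM PiE_UNIV_domain)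

lemma prob_UNIV [simp]: "measure Q UNIV = 1"
  using prob_space by simp

definition determined_by :: "nat set \<Rightarrow> (('s \<Rightarrow> real) \<Rightarrow> real) \<Rightarrow> bool" where
  "determined_by I F \<longleftrightarrow> (\<forall>x y. (\<forall>s. col s \<in> I \<longrightarrow> x s = y s) \<longrightarrow> F x = F y)"

lemma indep_vars_coordinates: "indep_vars N (\<lambda>s x. x s) UNIV"
proof (subst indep_vars_iff_distr_eq_PiM)
  have "distr Q (N s) (\<lambda>x. x s) = N s" for s
    by (rule distr_PiM_component) (auto intro: prob_N)
  then show "distr Q (Pi\<^sub>M UNIV N) (\<lambda>x. \<lambda>s\<in>UNIV. x s) = (\<Pi>\<^sub>M s\<in>UNIV. distr Q (N s) (\<lambda>x. x s))"
    by (simp add: restrict_def distr_id)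
qed auto

text \<open>Restrictions of the coordinates to disjoint index blocks are independent, and a function
  determined by its block is a measurable function of that restriction.\<close>

lemma indep_vars_determined:
  assumes F [measurable]: "\<And>j. j \<in> J \<Longrightarrow> F j \<in> borel_measurable Q"
    and det: "\<And>j. j \<in> J \<Longrightarrow> determined_by (I j) (F j)"
    and disj: "disjoint_family_on I J"
  shows "indep_vars (\<lambda>_. borel) F J"
proof -
  define K where "K j = {s. col s \<in> I j}" for j
  \<comment> \<open>Refilling the forgotten coordinates with 0 makes a full point out of a
    restricted one; the value of \<open>F j\<close> does not notice the change.\<close>
  define ext where "ext j z s = (if s \<in> K j then z s else 0 :: real)" for j z s
  have "indep_vars (\<lambda>j. Pi\<^sub>M (K j) N) (\<lambda>j x. restrict (\<lambda>s. x s) (K j)) J"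
    using disj by (intro indep_vars_restrict[OF indep_vars_coordinates])
      (auto simp: K_def disjoint_family_on_def)
  moreover have "ext j \<in> measurable (Pi\<^sub>M (K j) N) Q" for j
  proof -
    have "(\<lambda>z. \<lambda>s\<in>UNIV. ext j z s) \<in> measurable (Pi\<^sub>M (K j) N) Q"
    proof (rule measurable_restrict)
      show "(\<lambda>z. ext j z s) \<in> measurable (Pi\<^sub>M (K j) N) (N s)" for s
        by (cases "s \<in> K j") (auto simp: ext_def)
    qed
    then show ?thesis by (simp add: restrict_def)
  qed
  ultimately have "indep_vars (\<lambda>_. borel) (\<lambda>j x. F j (ext j (restrict (\<lambda>s. x s) (K j)))) J"
    by (intro indep_vars_compose2[where Y = "\<lambda>j z. F j (ext j z)"] measurable_compose[OF _ F])
  moreover have "F j (ext j (restrict (\<lambda>s. x s) (K j))) = F j x" if "j \<in> J" for j x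
    using det[OF that] unfolding determined_by_def
    by (elim allE impE) (auto simp: ext_def K_def)
  ultimately show ?thesis
    using indep_vars_cong[OF refl, of J "\<lambda>j x. F j (ext j (restrict (\<lambda>s. x s) (K j)))" F "\<lambda>_. borel" "\<lambda>_. borel"]
    by (auto simp: fun_eq_iff)
qed

lemma indep_var_determined:
  assumes "X \<in> borel_measurable Q" "Y \<in> borel_measurable Q"
    and "determined_by I X" "determined_by J Y" "I \<inter> J = {}"
  shows "indep_var borel X borel Y"
proof -
  have "indep_vars (\<lambda>_. borel) (case_bool X Y) UNIV"
    using assms by (intro indep_vars_determined[where I = "case_bool I J"])
      (auto simp: disjoint_family_on_def split: bool.splits)
  moreover have "case_bool borel borel = (\<lambda>_. borel :: real measure)"
    by (simp add: fun_eq_iff split: bool.splits)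
  ultimately show ?thesis unfolding indep_var_def by metis
qed

end

lemma (in real_product_space) coordinate_measurable [measurable]: "(\<lambda>x. x s) \<in> borel_measurable Q"
  using measurable_component_singleton[of s UNIV N] by simp

lemma (in real_product_space) distr_coordinate: "distr Q borel (\<lambda>x. x s) = N s"
proof -
  have "distr Q borel (\<lambda>x. x s) = distr Q (N s) (\<lambda>x. x s)" by (intro distr_cong) auto
  also have "\<dots> = N s" by (intro distr_PiM_component) (auto intro: prob_N)
  finally show ?thesis .
qed

lemma (in real_product_space) coordinate_L2:
  assumes "integrable (N s) (\<lambda>t. t\<^sup>2)"
  shows "(\<lambda>x. x s) \<in> L2"
proof -
  have "integrable (distr Q borel (\<lambda>x. x s)) (\<lambda>t. t\<^sup>2)" using assms by (simp add: distr_coordinate)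
  then show ?thesis by (simp add: L2_def integrable_distr_eq)
qed

lemma (in real_product_space) expectation_coordinate_square:
  "expectation (\<lambda>x. (x s)\<^sup>2) = (\<integral>t. t\<^sup>2 \<partial>N s)"
  using integral_distr[of "\<lambda>x. x s" Q borel "\<lambda>t. t\<^sup>2"] by (simp add: distr_coordinate)

lemma (in real_product_space) sum_abs_coordinates_L2:
  assumes "\<And>s. integrable (N s) (\<lambda>t. t\<^sup>2)"
  shows "(\<lambda>x. \<Sum>s\<in>S. \<bar>x s\<bar>) \<in> L2"
  by (intro L2_sum L2_dominated[OF coordinate_L2[OF assms]]) auto

lemma (in real_product_space) sum_abs_coordinates_second_moment:
  assumes "\<And>s. integrable (N s) (\<lambda>t. t\<^sup>2)" "\<And>s. (\<integral>t. t\<^sup>2 \<partial>N s) \<le> B"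
  shows "expectation (\<lambda>x. (\<Sum>s\<in>S. \<bar>x s\<bar>)\<^sup>2) \<le> (real (card S))\<^sup>2 * B"
proof -
  have int: "integrable Q (\<lambda>x. (x s)\<^sup>2)" for s
    using coordinate_L2[OF assms(1)] by (rule L2_integrable_square)
  have "expectation (\<lambda>x. (\<Sum>s\<in>S. \<bar>x s\<bar>)\<^sup>2) \<le> expectation (\<lambda>x. (\<Sum>s\<in>S. (x s)\<^sup>2) * real (card S))"
  proof (rule integral_mono)
    show "integrable Q (\<lambda>x. (\<Sum>s\<in>S. \<bar>x s\<bar>)\<^sup>2)"
      by (intro L2_integrable_square sum_abs_coordinates_L2 assms)
    show "integrable Q (\<lambda>x. (\<Sum>s\<in>S. (x s)\<^sup>2) * real (card S))"
      using int by auto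
    show "(\<Sum>s\<in>S. \<bar>x s\<bar>)\<^sup>2 \<le> (\<Sum>s\<in>S. (x s)\<^sup>2) * real (card S)" for x
      using sum_squared_le_sum_of_squares[of "\<lambda>s. \<bar>x s\<bar>" S] by simp
  qed
  also have "\<dots> = (\<Sum>s\<in>S. \<integral>t. t\<^sup>2 \<partial>N s) * real (card S)"
    using int by (simp add: expectation_coordinate_square)
  also have "\<dots> \<le> (real (card S) * B) * real (card S)"
    by (intro mult_right_mono sum_bounded_above assms) auto
  finally show ?thesis by (simp add: power2_eq_square algebra_simps)
qed

text \<open>The joint law of an independent family is the product of its laws, which is also the
  marginal of the big product. Hence the law of any functional of the weights can be computed on one
  fixed space.\<close>

lemma (in prob_space) distr_indep_vars_eq_distr_PiM:
  fixes X :: "'s \<Rightarrow> 'a \<Rightarrow> real"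
  assumes "I \<noteq> {}" and X: "indep_vars (\<lambda>_. borel) X I"
    and law: "\<And>s. s \<in> I \<Longrightarrow> distr M borel (X s) = N s"
    and N: "\<And>s. prob_space (N s)" "\<And>s. sets (N s) = sets borel"
    and f: "f \<in> borel_measurable (Pi\<^sub>M I (\<lambda>_. borel))"
  shows "distr M borel (\<lambda>x. f (\<lambda>s\<in>I. X s x)) = distr (Pi\<^sub>M UNIV N) borel (\<lambda>x. f (\<lambda>s\<in>I. x s))"
proof -
  have rv: "X s \<in> borel_measurable M" if "s \<in> I" for s
    using X that by (simp add: indep_vars_def)
  have sets_eq: "sets (Pi\<^sub>M I N) = sets (Pi\<^sub>M I (\<lambda>_. borel))"
    by (intro sets_PiM_cong N refl)
  have "distr M (Pi\<^sub>M I (\<lambda>_. borel)) (\<lambda>x. \<lambda>s\<in>I. X s x) = (\<Pi>\<^sub>M s\<in>I. distr M borel (X s))"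
    using indep_vars_iff_distr_eq_PiM'[where X = X and M' = "\<lambda>_. borel", OF assms(1) rv] X by simp
  also have "\<dots> = Pi\<^sub>M I N" by (intro PiM_cong law refl)
  also have "\<dots> = distr (Pi\<^sub>M UNIV N) (Pi\<^sub>M I N) (\<lambda>x. \<lambda>s\<in>I. x s)"
    using distr_PiM_reindex[of UNIV N "\<lambda>s. s" I] N by simp
  also have "\<dots> = distr (Pi\<^sub>M UNIV N) (Pi\<^sub>M I (\<lambda>_. borel)) (\<lambda>x. \<lambda>s\<in>I. x s)"
    by (intro distr_cong sets_eq refl)
  finally have "distr (distr M (Pi\<^sub>M I (\<lambda>_. borel)) (\<lambda>x. \<lambda>s\<in>I. X s x)) borel f
    = distr (distr (Pi\<^sub>M UNIV N) (Pi\<^sub>M I (\<lambda>_. borel)) (\<lambda>x. \<lambda>s\<in>I. x s)) borel f"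
    by simp
  moreover have "(\<lambda>x. \<lambda>s\<in>I. X s x) \<in> measurable M (Pi\<^sub>M I (\<lambda>_. borel))"
    by (intro measurable_restrict rv)
  moreover have "(\<lambda>x. \<lambda>s\<in>I. x s) \<in> measurable (Pi\<^sub>M UNIV N) (Pi\<^sub>M I (\<lambda>_. borel))"
    using measurable_component_singleton[of _ UNIV N]
    by (intro measurable_restrict) (simp add: measurable_cong_sets[OF refl N(2)])
  ultimately show ?thesis
    using f by (simp add: distr_distr comp_def)
qed

section \<open>Almost additive stationary processes\<close>

text \<open>Late terms are compared with one fixed early term \<open>u L\<close> instead of with
  each other; this suffices since the tolerance tends to 0 with L.\<close>

lemma convergent_if_eventually_close:
  fixes u :: "nat \<Rightarrow> real"
  assumes close: "\<And>L \<epsilon>. L \<ge> 1 \<Longrightarrow> \<epsilon> > 0 \<Longrightarrow> \<forall>\<^sub>F n in sequentially. \<bar>u n - u L\<bar> \<le> A / sqrt (real L) + \<epsilon>"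
  shows "convergent u"
proof -
  have "Cauchy u"
  proof (rule metric_CauchyI)
    fix e :: real assume e: "e > 0"
    have "(\<lambda>L. A / sqrt (real L)) \<longlonglongrightarrow> 0"
      by (intro tendsto_divide_0[OF tendsto_const] filterlim_at_top_imp_at_infinity
          filterlim_compose[OF sqrt_at_top] filterlim_real_sequentially)
    then have "\<forall>\<^sub>F L in sequentially. A / sqrt (real L) < e / 4"
      using e by (intro order_tendstoD) auto
    then have "\<forall>\<^sub>F L in sequentially. A / sqrt (real L) < e / 4 \<and> L \<ge> 1"
      using eventually_ge_at_top[of 1] by (rule eventually_conj)
    then obtain L where L: "A / sqrt (real L) < e / 4" "L \<ge> 1"
      using eventually_happens trivial_limit_sequentially by blast
    \<comment> \<open>Each late term is within e/4 + e/8 of \<open>u L\<close>, so two of them are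
      within 3e/4 of each other.\<close>
    obtain n0 where n0: "\<And>n. n \<ge> n0 \<Longrightarrow> \<bar>u n - u L\<bar> \<le> A / sqrt (real L) + e / 8"
      using close[OF L(2), of "e / 8"] e by (auto simp: eventually_sequentially)
    have "dist (u m) (u n) < e" if "m \<ge> n0" "n \<ge> n0" for m n
      using n0[OF that(1)] n0[OF that(2)] L(1) e unfolding dist_real_def by linarith
    then show "\<exists>n0. \<forall>m\<ge>n0. \<forall>n\<ge>n0. dist (u m) (u n) < e" by blast
  qed
  then show ?thesis by (simp add: Cauchy_convergent_iff)
qed

text \<open>Quantitative strict concavity of the square root. Any factor above 1 would leave slack
  in the halving recursion; 4/3 is a convenient rational below (1 + sqrt 2) / sqrt 3, the ratio in
  the worst case k = 3.\<close>

lemma sqrt_halves_ge: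
  assumes "k \<ge> 2"
  shows "4 / 3 * sqrt (real k) \<le> sqrt (real (k div 2)) + sqrt (real (k - k div 2))"
proof -
  define p q where "p = real (k div 2)" and "q = real (k - k div 2)"
  have k: "real k = p + q" by (simp add: p_def q_def)
  \<comment> \<open>The two parts differ by at most one, so for k >= 2 their ratio is at most 2,
    attained at k = 3.\<close>
  have "k \<le> 3 * (k div 2)" "k div 2 \<le> k - k div 2" "k - k div 2 \<le> 2 * (k div 2)"
    using assms mod_less_divisor[of 2 k] div_mult_mod_eq[of k 2] by linarith+
  then have b: "p \<le> q" "q \<le> 2 * p" unfolding p_def q_def by linarith+
  have pos: "0 \<le> (q - p) * (2 * p - q)" "0 \<le> p * q" "0 \<le> p * p"
    using b by auto
  have "q * q + 2 * (p * p) \<le> 3 * (p * q)"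
    using pos(1) by (simp add: algebra_simps)
  then have "49 * (p * p) + 49 * (q * q) \<le> 226 * (p * q)"
    using pos(2,3) by linarith
  \<comment> \<open>Squaring the goal leaves 16/9 (p + q) <= p + q + 2 sqrt (p q), that is 7/18 (p +
    q) <= sqrt (p q).\<close>
  then have "(7 / 18 * (p + q))\<^sup>2 \<le> p * q"
    by (simp add: power2_eq_square algebra_simps)
  then have "7 / 18 * (p + q) \<le> sqrt (p * q)" by (intro real_le_rsqrt)
  moreover have nonneg: "0 \<le> p" "0 \<le> q" by (simp_all add: p_def q_def)
  moreover have lhs: "(4 / 3 * sqrt (p + q))\<^sup>2 = 16 / 9 * (p + q)"
    using nonneg by (simp add: power_mult_distrib power2_eq_square)
  moreover have rhs: "(sqrt p + sqrt q)\<^sup>2 = p + q + 2 * sqrt (p * q)"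
    using nonneg by (simp add: power2_sum real_sqrt_mult)
  ultimately have "(4 / 3 * sqrt (p + q))\<^sup>2 \<le> (sqrt p + sqrt q)\<^sup>2"
    unfolding lhs rhs by (simp add: algebra_simps)
  then have "4 / 3 * sqrt (p + q) \<le> sqrt p + sqrt q"
    by (rule power2_le_imp_le) (simp add: nonneg)
  then show ?thesis
    by (simp only: k p_def[symmetric] q_def[symmetric])
qed

lemma sum_lessThan_add:
  fixes f :: "nat \<Rightarrow> 'a :: comm_monoid_add"
  shows "(\<Sum>i<p + q. f i) = (\<Sum>i<p. f i) + (\<Sum>i<q. f (p + i))"
  by (induction q) (auto simp: add_ac)

lemma (in prob_space) distr_eq_imp_expectation_eq:
  fixes X Y :: "'a \<Rightarrow> real"
  assumes "X \<in> borel_measurable M" "Y \<in> borel_measurable M" "distr M borel X = distr M borel Y"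
  shows "expectation X = expectation Y"
  using integral_distr[OF assms(1), of "\<lambda>x. x"] integral_distr[OF assms(2), of "\<lambda>x. x"] assms(3) by simp

lemma (in prob_space) distr_eq_imp_variance_eq:
  fixes X Y :: "'a \<Rightarrow> real"
  assumes "X \<in> borel_measurable M" "Y \<in> borel_measurable M" "distr M borel X = distr M borel Y"
  shows "variance X = variance Y"
  using integral_distr[OF assms(1), of "\<lambda>x. (x - expectation X)\<^sup>2"]
    integral_distr[OF assms(2), of "\<lambda>x. (x - expectation X)\<^sup>2"]
    distr_eq_imp_expectation_eq[OF assms] assms(3) by simp

text \<open>All that the limit theorems use of the energies: locality, stationarity, and a cost per
  cut that is bounded by C in \<open>L2\<close> uniformly in the lengths on both sides. The index
  \<open>a\<close> counts the columns before the window, which starts at column a + 1.\<close>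

locale almost_additive = real_product_space +
  fixes W :: "nat \<Rightarrow> nat \<Rightarrow> ('a \<Rightarrow> real) \<Rightarrow> real" and C :: real
  assumes W_L2: "\<And>a l. W a l \<in> L2"
    and W_determined: "\<And>a l. determined_by {a<..a + l} (W a l)"
    and W_distr: "\<And>a l. distr Q borel (W a l) = distr Q borel (W 0 l)"
    and W_additive: "\<And>a k l. expectation (\<lambda>x. (W a (k + l) x - W a k x - W (a + k) l x)\<^sup>2) \<le> C\<^sup>2"
    and C_nonneg: "0 \<le> C"
begin

section \<open>Errors of cutting a window into many blocks\<close>

definition block_error :: "nat \<Rightarrow> nat \<Rightarrow> nat \<Rightarrow> ('a \<Rightarrow> real) \<Rightarrow> real" where
  "block_error L a k = (\<lambda>x. W a (k * L) x - (\<Sum>i<k. W (a + i * L) L x))"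

definition defect :: "nat \<Rightarrow> nat \<Rightarrow> nat \<Rightarrow> ('a \<Rightarrow> real) \<Rightarrow> real" where
  "defect a k l = (\<lambda>x. W a (k + l) x - W a k x - W (a + k) l x)"

lemma W_measurable [measurable]: "W a l \<in> borel_measurable Q"
  by (rule L2_measurable[OF W_L2])

lemma W_integrable [simp]: "integrable Q (W a l)"
  by (rule L2_integrable[OF W_L2])

lemma expectation_W: "expectation (W a l) = expectation (W 0 l)"
  by (intro distr_eq_imp_expectation_eq W_distr) measurable

lemma variance_W: "variance (W a l) = variance (W 0 l)"
  by (intro distr_eq_imp_variance_eq W_distr) measurable

lemma std_dev_W: "std_dev (W a l) = std_dev (W 0 l)"
  using variance_W by (simp add: std_dev_def)

lemma block_error_L2: "block_error L a k \<in> L2"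
  unfolding block_error_def by (intro L2_intros W_L2)

lemma defect_L2: "defect a k l \<in> L2"
  unfolding defect_def by (intro L2_intros W_L2)

lemma defect_second_moment: "sqrt (expectation (\<lambda>x. (defect a k l x)\<^sup>2)) \<le> C"
  unfolding defect_def using W_additive[of a k l] C_nonneg by (intro real_le_lsqrt) auto

lemma std_dev_defect_le: "std_dev (defect a k l) \<le> C"
  using std_dev_le_second_moment[OF defect_L2] defect_second_moment by (rule order_trans)

lemma expectation_defect_le: "\<bar>expectation (defect a k l)\<bar> \<le> C"
proof -
  have "\<bar>expectation (defect a k l)\<bar> \<le> expectation (\<lambda>x. \<bar>defect a k l x\<bar>)"
    by (rule integral_abs_bound)
  also have "\<dots> \<le> C"
    using expectation_abs_le_second_moment[OF defect_L2] defect_second_moment by (rule order_trans)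
  finally show ?thesis .
qed

text \<open>The error of a window depends on the weights of that window alone. This is what makes
  the errors of two adjacent windows independent.\<close>

lemma block_error_determined: "determined_by {a<..a + k * L} (block_error L a k)"
proof -
  have "W a (k * L) x = W a (k * L) y" "i < k \<Longrightarrow> W (a + i * L) L x = W (a + i * L) L y"
    if *: "\<forall>s. col s \<in> {a<..a + k * L} \<longrightarrow> x s = y s" for x y i
  proof -
    show "W a (k * L) x = W a (k * L) y"
      using W_determined * unfolding determined_by_def by blast
    assume "i < k"
    then have "Suc i * L \<le> k * L" by (intro mult_le_mono1) simp
    then have "{a + i * L<..a + i * L + L} \<subseteq> {a<..a + k * L}" by auto
    then show "W (a + i * L) L x = W (a + i * L) L y"
      using W_determined[of "a + i * L" L] * unfolding determined_by_def by blast
  qed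
  then show ?thesis
    unfolding determined_by_def block_error_def
    by (intro allI impI arg_cong2[where f = "(-)"] sum.cong) auto
qed

lemma block_error_add:
  "block_error L a (p + q) = (\<lambda>x. (block_error L a p x + block_error L (a + p * L) q x) + defect a (p * L) (q * L) x)"
  unfolding block_error_def defect_def sum_lessThan_add by (simp add: fun_eq_iff algebra_simps)

text \<open>The errors of the two halves are independent, so their variances add. The defect of the
  middle cut depends on both halves and can only be added by the triangle inequality.\<close>

lemma std_dev_block_error_add:
  "std_dev (block_error L a (p + q))
    \<le> sqrt ((std_dev (block_error L a p))\<^sup>2 + (std_dev (block_error L (a + p * L) q))\<^sup>2) + C"
proof -
  let ?X = "block_error L a p" and ?Y = "block_error L (a + p * L) q"
  have "indep_var borel ?X borel ?Y"
  proof (rule indep_var_determined)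
    show "determined_by {a<..a + p * L} ?X" "determined_by {a + p * L<..a + p * L + q * L} ?Y"
      by (rule block_error_determined)+
  qed (auto intro: L2_measurable block_error_L2)
  then have "variance (\<lambda>x. ?X x + ?Y x) = variance ?X + variance ?Y"
    by (intro variance_add_indep block_error_L2)
  then have "std_dev (\<lambda>x. ?X x + ?Y x) = sqrt ((std_dev ?X)\<^sup>2 + (std_dev ?Y)\<^sup>2)"
    by (simp add: std_dev_def)
  moreover have "std_dev (block_error L a (p + q))
      \<le> std_dev (\<lambda>x. ?X x + ?Y x) + std_dev (defect a (p * L) (q * L))"
    unfolding block_error_add by (intro std_dev_add_le L2_intros block_error_L2 defect_L2)
  ultimately show ?thesis using std_dev_defect_le[of a "p * L" "q * L"] by simp
qed

text \<open>The term \<open>- 4\<close> absorbs the defect that each halving step of the induction adds.\<close>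

lemma std_dev_block_error_le:
  assumes "k \<ge> 1"
  shows "std_dev (block_error L a k) \<le> C * (11 * sqrt (real k) - 4)"
  using assms
proof (induction k arbitrary: a rule: less_induct)
  case (less k)
  show ?case
  proof (cases "k = 1")
    case True
    then show ?thesis using C_nonneg by (simp add: block_error_def)
  next
    case False
    define p q where "p = k div 2" and "q = k - k div 2"
    have pq: "k = p + q" "1 \<le> p" "p < k" "1 \<le> q" "q < k" "k \<ge> 2"
      using less.prems False by (auto simp: p_def q_def)
    define P R K where "P = sqrt (real p)" and "R = sqrt (real q)" and "K = sqrt (real k)"
    have sq: "P\<^sup>2 + R\<^sup>2 = K\<^sup>2" using pq(1) by (simp add: P_def R_def K_def)
    have K: "4 / 3 * K \<le> P + R"
      using sqrt_halves_ge[OF pq(6)] by (simp add: P_def R_def K_def p_def q_def)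
    have "sqrt ((21 / 20)\<^sup>2) \<le> K"
      unfolding K_def using pq(6) by (intro real_sqrt_le_mono) (simp add: power2_eq_square)
    then have K1: "21 / 20 \<le> K" by simp
    have IH: "(std_dev (block_error L a p))\<^sup>2 \<le> (C * (11 * P - 4))\<^sup>2"
        "(std_dev (block_error L (a + p * L) q))\<^sup>2 \<le> (C * (11 * R - 4))\<^sup>2"
      unfolding P_def R_def by (intro power_mono less.IH pq std_dev_nonneg)+
    \<comment> \<open>The target is 11 K - 5 rather than 11 K - 4, so that the defect C of the
      middle cut restores the -4.\<close>
    have "(11 * P - 4)\<^sup>2 + (11 * R - 4)\<^sup>2 = 121 * (P\<^sup>2 + R\<^sup>2) - 88 * (P + R) + 32"
      by (simp add: power2_eq_square algebra_simps)
    also have "\<dots> \<le> 121 * K\<^sup>2 - 110 * K + 25"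
    proof -
      \<comment> \<open>By concavity 88 (P + R) >= 352/3 K, and the surplus 22/3 K over 110 K
        exceeds 7 because K >= 21/20.\<close>
      have "110 * K + 7 \<le> 88 * (P + R)" using K K1 by simp
      then show ?thesis unfolding sq by simp
    qed
    also have "\<dots> = (11 * K - 5)\<^sup>2"
      by (simp add: power2_eq_square algebra_simps)
    finally have "C\<^sup>2 * ((11 * P - 4)\<^sup>2 + (11 * R - 4)\<^sup>2) \<le> C\<^sup>2 * (11 * K - 5)\<^sup>2"
      by (intro mult_left_mono) auto
    then have "(std_dev (block_error L a p))\<^sup>2 + (std_dev (block_error L (a + p * L) q))\<^sup>2 \<le> (C * (11 * K - 5))\<^sup>2"
      using add_mono[OF IH] unfolding power_mult_distrib distrib_left by (rule order_trans[rotated])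
    then have "sqrt ((std_dev (block_error L a p))\<^sup>2 + (std_dev (block_error L (a + p * L) q))\<^sup>2) \<le> C * (11 * K - 5)"
      using C_nonneg K1 by (intro real_le_lsqrt) auto
    then have "std_dev (block_error L a (p + q)) \<le> C * (11 * K - 5) + C"
      using std_dev_block_error_add[of L a p q] by linarith
    then show ?thesis by (simp add: pq(1)[symmetric] K_def algebra_simps)
  qed
qed

text \<open>One block is split off at a time, each time at the cost of one defect. A bound linear in
  k suffices: with k L <= n, division by n leaves at most C / L.\<close>

lemma expectation_block_error_le:
  assumes "k \<ge> 1"
  shows "\<bar>expectation (block_error L a k)\<bar> \<le> C * real k"
  using assms
proof (induction k rule: nat_induct_at_least)
  case base
  then show ?case using C_nonneg by (simp add: block_error_def)
next
  case (Suc k)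
  have "expectation (block_error L a (k + 1)) = expectation (block_error L a k)
      + expectation (block_error L (a + k * L) 1) + expectation (defect a (k * L) (1 * L))"
    unfolding block_error_add using L2_integrable[OF block_error_L2] L2_integrable[OF defect_L2] by simp
  also have "expectation (block_error L (a + k * L) 1) = 0" by (simp add: block_error_def)
  finally show ?case
    using Suc.IH expectation_defect_le[of a "k * L" "1 * L"] by (simp add: algebra_simps)
qed

text \<open>The counterpart of \<open>block_error\<close> when L need not divide n: the n mod L
  columns left over at the right end count as error.\<close>

definition remainder :: "nat \<Rightarrow> nat \<Rightarrow> ('a \<Rightarrow> real) \<Rightarrow> real" where
  "remainder L n = (\<lambda>x. W 0 n x - (\<Sum>i<n div L. W (i * L) L x))"

lemma remainder_eq:
  "remainder L n = (\<lambda>x. (block_error L 0 (n div L) x + W (n div L * L) (n mod L) x)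
     + defect 0 (n div L * L) (n mod L) x)"
  unfolding remainder_def block_error_def defect_def by (simp add: fun_eq_iff)

lemma remainder_L2: "remainder L n \<in> L2"
  unfolding remainder_def by (intro L2_intros W_L2)

lemma std_dev_remainder_le:
  assumes "1 \<le> L" "L \<le> n"
  shows "std_dev (remainder L n) \<le> 11 * C * sqrt (real (n div L)) + ((\<Sum>r<L. std_dev (W 0 r)) + C)"
proof -
  have "1 \<le> n div L" using assms div_greater_zero_iff[of n L] by simp
  have "std_dev (remainder L n) \<le> std_dev (block_error L 0 (n div L)) + std_dev (W (n div L * L) (n mod L))
     + std_dev (defect 0 (n div L * L) (n mod L))"
    unfolding remainder_eq
    by (intro order_trans[OF std_dev_add_le] add_right_mono L2_intros block_error_L2 defect_L2 W_L2 order_refl)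
  also have "\<dots> \<le> C * (11 * sqrt (real (n div L)) - 4) + (\<Sum>r<L. std_dev (W 0 r)) + C"
  proof (intro add_mono std_dev_block_error_le std_dev_defect_le)
    \<comment> \<open>The leftover slab has one of the finitely many lengths r < L, so the sum over
      all of them is a bound free of n.\<close>
    show "std_dev (W (n div L * L) (n mod L)) \<le> (\<Sum>r<L. std_dev (W 0 r))"
      unfolding std_dev_W[of "n div L * L"] using assms by (intro member_le_sum) auto
  qed fact
  also have "\<dots> \<le> 11 * C * sqrt (real (n div L)) + ((\<Sum>r<L. std_dev (W 0 r)) + C)"
    using C_nonneg by (simp add: algebra_simps)
  finally show ?thesis .
qed

lemma expectation_remainder_le:
  assumes "1 \<le> L" "L \<le> n"
  shows "\<bar>expectation (W 0 n) - real (n div L) * expectation (W 0 L)\<bar>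
    \<le> C * real (n div L) + ((\<Sum>r<L. \<bar>expectation (W 0 r)\<bar>) + C)"
proof -
  have k: "1 \<le> n div L" using assms div_greater_zero_iff[of n L] by simp
  have "expectation (remainder L n) = expectation (W 0 n) - real (n div L) * expectation (W 0 L)"
    unfolding remainder_def by (simp add: expectation_W[of "_ * L"])
  moreover have "expectation (remainder L n) = expectation (block_error L 0 (n div L))
     + expectation (W 0 (n mod L)) + expectation (defect 0 (n div L * L) (n mod L))"
    unfolding remainder_eq using L2_integrable[OF block_error_L2] L2_integrable[OF defect_L2]
    by (simp add: expectation_W[of "n div L * L"])
  moreover have "\<bar>expectation (W 0 (n mod L))\<bar> \<le> (\<Sum>r<L. \<bar>expectation (W 0 r)\<bar>)"
    using assms by (intro member_le_sum[where f = "\<lambda>r. \<bar>expectation (W 0 r)\<bar>"]) auto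
  ultimately show ?thesis
    using expectation_block_error_le[OF k, of L 0] expectation_defect_le[of 0 "n div L * L" "n mod L"]
    by linarith
qed

end

section \<open>Weak convergence and characteristic functions of normal laws\<close>

text \<open>Weak convergence ignores finitely many laws. It is applied with \<open>n0\<close> = 1,
  because nothing is assumed about the space \<open>P 0\<close>.\<close>

lemma weak_conv_m_cong:
  assumes "\<And>n. n \<ge> n0 \<Longrightarrow> \<mu> n = \<mu>' n" "weak_conv_m \<mu> L"
  shows "weak_conv_m \<mu>' L"
  unfolding weak_conv_m_def weak_conv_def
proof (intro allI impI)
  fix x assume "isCont (cdf L) x"
  then have "(\<lambda>n. cdf (\<mu> n) x) \<longlonglongrightarrow> cdf L x"
    using assms(2) by (simp add: weak_conv_m_def weak_conv_def)
  moreover have "\<forall>\<^sub>F n in sequentially. cdf (\<mu> n) x = cdf (\<mu>' n) x"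
    using eventually_ge_at_top[of n0] by eventually_elim (simp add: assms(1))
  ultimately show "(\<lambda>n. cdf (\<mu>' n) x) \<longlonglongrightarrow> cdf L x"
    by (rule Lim_transform_eventually)
qed

lemma normal_law_real_distribution:
  assumes "0 \<le> \<sigma>"
  shows "real_distribution (normal_law a \<sigma>)"
proof (cases "\<sigma> = 0")
  case True
  then show ?thesis
    by (auto simp: normal_law_def real_distribution_def real_distribution_axioms_def intro!: prob_space_return)
next
  case False
  then show ?thesis
    using assms by (auto simp: normal_law_def real_distribution_def real_distribution_axioms_def
        intro!: prob_space_normal_density)
qed

text \<open>Rescaling reduces the density case to the standard normal law. The formula also covers
  the Dirac mass, so the limit argument needs no case distinction on
  \<open>\<sigma>\<close>.\<close>

lemma char_normal_law:
  assumes "0 \<le> \<sigma>"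
  shows "char (normal_law 0 \<sigma>) t = of_real (exp (- (t * \<sigma>)\<^sup>2 / 2))"
proof (cases "\<sigma> = 0")
  case True
  then show ?thesis by (simp add: normal_law_def char_def integral_return)
next
  case False
  then have \<sigma>: "\<sigma> > 0" using assms by simp
  let ?M = "density lborel (\<lambda>x. ennreal (normal_density 0 \<sigma> x))"
  interpret prob_space ?M using \<sigma> by (rule prob_space_normal_density)
  have "distributed ?M lborel (\<lambda>x. x) (normal_density 0 \<sigma>)"
    by (auto simp: distributed_def distr_id2)
  then have "distributed ?M lborel (\<lambda>x. (x - 0) / \<sigma>) std_normal_density"
    by (rule iffD1[OF normal_standard_normal_convert[OF \<sigma>]])
  then have std: "distr ?M lborel (\<lambda>x. x / \<sigma>) = std_normal_distribution"
    by (simp add: distributed_def)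
  have "char ?M t = (CLINT x | ?M. iexp (t * \<sigma> * (x / \<sigma>)))"
    using \<sigma> by (simp add: char_def)
  also have "\<dots> = (CLINT y | distr ?M lborel (\<lambda>x. x / \<sigma>). iexp (t * \<sigma> * y))"
    by (subst integral_distr) auto
  also have "\<dots> = char std_normal_distribution (t * \<sigma>)"
    unfolding std by (simp add: char_def)
  finally show ?thesis
    using False by (simp add: normal_law_def char_std_normal_distribution)
qed

section \<open>Limits of means, standard deviations and laws\<close>

context almost_additive
begin

definition block_sum :: "nat \<Rightarrow> nat \<Rightarrow> ('a \<Rightarrow> real) \<Rightarrow> real" where
  "block_sum L k = (\<lambda>x. \<Sum>i<k. W (i * L) L x)"

definition normalized :: "nat \<Rightarrow> ('a \<Rightarrow> real) \<Rightarrow> real" where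
  "normalized n = (\<lambda>x. (W 0 n x - expectation (W 0 n)) / sqrt (real n))"

text \<open>Scaled by the number k L of columns actually covered instead of n, so that the standard
  deviation is the same for every k >= 1.\<close>

definition normalized_blocks :: "nat \<Rightarrow> nat \<Rightarrow> ('a \<Rightarrow> real) \<Rightarrow> real" where
  "normalized_blocks L k = (\<lambda>x. (block_sum L k x - real k * expectation (W 0 L)) / sqrt (real k * real L))"

lemma block_sum_L2: "block_sum L k \<in> L2"
  unfolding block_sum_def by (intro L2_intros W_L2)

lemma normalized_L2: "normalized n \<in> L2"
  unfolding normalized_def by (intro L2_intros W_L2)

lemma normalized_blocks_L2: "normalized_blocks L k \<in> L2"
  unfolding normalized_blocks_def by (intro L2_intros block_sum_L2)

lemma std_dev_shift: "X \<in> L2 \<Longrightarrow> std_dev (\<lambda>x. X x - c) = std_dev X"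
  using L2_integrable[of X] by (simp add: std_dev_def prob_space)

lemma std_dev_normalized: "std_dev (normalized n) = std_dev (W 0 n) / sqrt (real n)"
  unfolding normalized_def by (simp add: std_dev_divide std_dev_shift L2_intros W_L2)

lemma indep_vars_blocks: "indep_vars (\<lambda>_. borel) (\<lambda>i. W (i * L) L) I"
proof (rule indep_vars_determined)
  show "disjoint_family_on (\<lambda>i. {i * L<..i * L + L}) I"
  proof (unfold disjoint_family_on_def, intro ballI impI)
    have *: "{i * L<..i * L + L} \<inter> {j * L<..j * L + L} = {}" if "i < j" for i j
    proof -
      have "Suc i * L \<le> j * L" using that by (intro mult_le_mono1) simp
      then show ?thesis by auto
    qed
    fix i j :: nat assume "i \<noteq> j"
    then show "{i * L<..i * L + L} \<inter> {j * L<..j * L + L} = {}"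
      using *[of i j] *[of j i] by (cases "i < j") auto
  qed
qed (auto intro: W_determined)

lemma std_dev_block_sum: "std_dev (block_sum L k) = sqrt (real k) * std_dev (W 0 L)"
proof -
  have "variance (block_sum L k) = (\<Sum>i<k. variance (W (i * L) L))"
    unfolding block_sum_def by (intro variance_sum_indep W_L2 indep_vars_blocks) auto
  also have "\<dots> = real k * variance (W 0 L)"
    by (simp only: variance_W[of "_ * L"] sum_constant card_lessThan)
  finally show ?thesis by (simp add: std_dev_def real_sqrt_mult)
qed

lemma std_dev_normalized_blocks:
  assumes "1 \<le> k"
  shows "std_dev (normalized_blocks L k) = std_dev (W 0 L) / sqrt (real L)"
  unfolding normalized_blocks_def using assms
  by (simp add: std_dev_divide std_dev_shift L2_intros block_sum_L2 std_dev_block_sum real_sqrt_mult)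

text \<open>There are two sources of error. The remainder contributes sqrt k / sqrt n <= 1 / sqrt L,
  which persists as n grows; the change of scale from sqrt n to sqrt (k L) and the boundary terms
  vanish for fixed L.\<close>

lemma std_dev_normalized_diff_le:
  assumes "1 \<le> L" "L \<le> n"
  shows "std_dev (\<lambda>x. normalized n x - normalized_blocks L (n div L) x)
    \<le> 11 * C / sqrt (real L)
      + (((\<Sum>r<L. std_dev (W 0 r)) + C) / sqrt (real n) + std_dev (W 0 L) * real L / real n)"
proof -
  define k where "k = n div L"
  define B where "B = (\<Sum>r<L. std_dev (W 0 r)) + C"
  \<comment> \<open>The difference of the two scaling factors, which multiplies the block
    sum.\<close>
  define c where "c = 1 / sqrt (real n) - 1 / sqrt (real k * real L)"
  have k: "1 \<le> k" using assms div_greater_zero_iff[of n L] by (simp add: k_def)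
  have pos: "0 < real n" "0 < real L" "0 < real k" using assms k by auto
  have kL: "k * L \<le> n" "n < k * L + L"
    using assms div_mult_mod_eq[of n L] mod_less_divisor[of L n] unfolding k_def by linarith+
  then have kL': "real k * real L \<le> real n" "real n \<le> real k * real L + real L"
    by (simp_all flip: of_nat_mult of_nat_add)
  have eq: "normalized n x - normalized_blocks L k x
    = (remainder L n x / sqrt (real n) + c * block_sum L k x)
      - (expectation (W 0 n) / sqrt (real n) - real k * expectation (W 0 L) / sqrt (real k * real L))" for x
    by (simp add: normalized_def normalized_blocks_def remainder_def block_sum_def c_def k_def
        diff_divide_distrib left_diff_distrib)
  have "std_dev (\<lambda>x. normalized n x - normalized_blocks L k x)
    = std_dev (\<lambda>x. remainder L n x / sqrt (real n) + c * block_sum L k x)"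
    unfolding eq by (intro std_dev_shift L2_intros remainder_L2 block_sum_L2)
  also have "\<dots> \<le> std_dev (\<lambda>x. remainder L n x / sqrt (real n)) + std_dev (\<lambda>x. c * block_sum L k x)"
    by (intro std_dev_add_le L2_intros remainder_L2 block_sum_L2)
  also have "\<dots> = std_dev (remainder L n) / sqrt (real n) + \<bar>c\<bar> * sqrt (real k) * std_dev (W 0 L)"
    by (simp add: std_dev_divide std_dev_cmult remainder_L2 block_sum_L2 std_dev_block_sum)
  also have "\<dots> \<le> (11 * C / sqrt (real L) + B / sqrt (real n)) + (real L / real n) * std_dev (W 0 L)"
  proof (intro add_mono mult_right_mono)
    have "std_dev (remainder L n) \<le> 11 * C * sqrt (real k) + B"
      using std_dev_remainder_le[OF assms] by (simp add: k_def B_def)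
    then have "std_dev (remainder L n) / sqrt (real n) \<le> (11 * C * sqrt (real k) + B) / sqrt (real n)"
      by (intro divide_right_mono) auto
    also have "\<dots> = 11 * C * (sqrt (real k) / sqrt (real n)) + B / sqrt (real n)"
      by (simp add: add_divide_distrib)
    also have "\<dots> \<le> 11 * C * (1 / sqrt (real L)) + B / sqrt (real n)"
    proof -
      have "sqrt (real k) * sqrt (real L) \<le> sqrt (real n)"
        using kL'(1) by (simp flip: real_sqrt_mult)
      then show ?thesis
        using pos C_nonneg by (intro add_right_mono mult_left_mono) (auto simp: field_simps)
    qed
    finally show "std_dev (remainder L n) / sqrt (real n) \<le> 11 * C / sqrt (real L) + B / sqrt (real n)"
      by simp
    \<comment> \<open>The fraction of columns covered by full blocks. The relative change of scale
      is 1 - sqrt y, at most 1 - y since y <= sqrt y, and fewer than L columns are left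
      uncovered.\<close>
    define y where "y = real k * real L / real n"
    have "1 - y = (real n - real k * real L) / real n"
      using pos by (simp add: y_def diff_divide_distrib)
    also have "\<dots> \<le> real L / real n"
      using kL' by (intro divide_right_mono) auto
    finally have y: "0 \<le> y" "y \<le> 1" "1 - y \<le> real L / real n"
      using kL' pos by (auto simp: y_def field_simps)
    have "y \<le> sqrt y"
      using y by (intro real_le_rsqrt) (auto simp: power2_eq_square mult_left_le)
    have "\<bar>c\<bar> * sqrt (real k) \<le> \<bar>c\<bar> * sqrt (real k * real L)"
      using pos assms by (intro mult_left_mono real_sqrt_le_mono) auto
    also have "\<dots> = \<bar>c * sqrt (real k * real L)\<bar>"
      by (simp add: abs_mult)
    also have "c * sqrt (real k * real L) = sqrt y - 1"
      using pos by (simp add: c_def y_def left_diff_distrib real_sqrt_divide real_sqrt_mult)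
    also have "\<bar>sqrt y - 1\<bar> \<le> real L / real n"
      using y \<open>y \<le> sqrt y\<close> by simp
    finally show "\<bar>c\<bar> * sqrt (real k) \<le> real L / real n" .
  qed auto
  finally show ?thesis by (simp add: k_def B_def algebra_simps)
qed

lemma eventually_std_dev_normalized_diff_le:
  assumes "1 \<le> L" "0 < \<epsilon>"
  shows "\<forall>\<^sub>F n in sequentially.
    std_dev (\<lambda>x. normalized n x - normalized_blocks L (n div L) x) \<le> 11 * C / sqrt (real L) + \<epsilon>"
proof -
  define B where "B = (\<Sum>r<L. std_dev (W 0 r)) + C"
  have "(\<lambda>n. B / sqrt (real n) + std_dev (W 0 L) * real L / real n) \<longlonglongrightarrow> 0 + 0"
    by (intro tendsto_add tendsto_divide_0[OF tendsto_const] filterlim_at_top_imp_at_infinity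
        filterlim_compose[OF sqrt_at_top] filterlim_real_sequentially)
  then have "\<forall>\<^sub>F n in sequentially. B / sqrt (real n) + std_dev (W 0 L) * real L / real n < \<epsilon>"
    using assms(2) by (intro order_tendstoD) auto
  then show ?thesis
    using eventually_ge_at_top[of L]
  proof eventually_elim
    case (elim n)
    then show ?case using std_dev_normalized_diff_le[OF assms(1), of n] unfolding B_def by linarith
  qed
qed

text \<open>By the reverse triangle inequality: the normalized block sum has exactly the normalized
  standard deviation of a single block, whatever the number of blocks.\<close>

lemma eventually_std_dev_close:
  assumes "1 \<le> L" "0 < \<epsilon>"
  shows "\<forall>\<^sub>F n in sequentially. \<bar>std_dev (W 0 n) / sqrt (real n) - std_dev (W 0 L) / sqrt (real L)\<bar>
    \<le> 11 * C / sqrt (real L) + \<epsilon>"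
  using eventually_std_dev_normalized_diff_le[OF assms] eventually_ge_at_top[of L]
proof eventually_elim
  case (elim n)
  have "1 \<le> n div L" using assms elim div_greater_zero_iff[of n L] by simp
  then show ?case
    using std_dev_dist_le[OF normalized_L2[of n] normalized_blocks_L2[of L "n div L"]] elim
    by (simp add: std_dev_normalized std_dev_normalized_blocks)
qed

lemma convergent_std_dev: "convergent (\<lambda>n. std_dev (W 0 n) / sqrt (real n))"
  by (rule convergent_if_eventually_close) (rule eventually_std_dev_close)

lemma convergent_expectation: "convergent (\<lambda>n. expectation (W 0 n) / real n)"
proof (rule convergent_if_eventually_close)
  fix L :: nat and \<epsilon> :: real assume L: "1 \<le> L" and \<epsilon>: "0 < \<epsilon>"
  define B where "B = (\<Sum>r<L. \<bar>expectation (W 0 r)\<bar>) + C"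
  define e where "e = expectation (W 0 L)"
  have "(\<lambda>n. (B + \<bar>e\<bar>) / real n) \<longlonglongrightarrow> 0"
    by (intro tendsto_divide_0[OF tendsto_const] filterlim_at_top_imp_at_infinity filterlim_real_sequentially)
  then have "\<forall>\<^sub>F n in sequentially. (B + \<bar>e\<bar>) / real n < \<epsilon>"
    using \<epsilon> by (intro order_tendstoD) auto
  then show "\<forall>\<^sub>F n in sequentially. \<bar>expectation (W 0 n) / real n - expectation (W 0 L) / real L\<bar>
      \<le> C / sqrt (real L) + \<epsilon>"
    using eventually_ge_at_top[of L]
  proof eventually_elim
    case (elim n)
    define k where "k = n div L"
    have pos: "0 < real n" "0 < real L" using L elim by auto
    have kL: "k * L \<le> n" "n < k * L + L"
      using L div_mult_mod_eq[of n L] mod_less_divisor[of L n] unfolding k_def by linarith+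
    then have kL': "real k * real L \<le> real n" "real n \<le> real k * real L + real L"
      by (simp_all flip: of_nat_mult of_nat_add)
    \<comment> \<open>The first summand is the error of cutting into blocks, the second the mismatch
      between k L and n.\<close>
    have "expectation (W 0 n) / real n - e / real L
      = (expectation (W 0 n) - real k * e) / real n + e * ((real k * real L - real n) / (real n * real L))"
      using pos by (simp add: field_simps)
    also have "\<bar>\<dots>\<bar> \<le> (C * real k + B) / real n + \<bar>e\<bar> * (1 / real n)"
    proof (intro order_trans[OF abs_triangle_ineq] add_mono)
      show "\<bar>(expectation (W 0 n) - real k * e) / real n\<bar> \<le> (C * real k + B) / real n"
        using expectation_remainder_le[OF L elim(2)] pos
        by (simp add: abs_divide k_def e_def B_def divide_right_mono)
      have "\<bar>(real k * real L - real n) / (real n * real L)\<bar> = (real n - real k * real L) / (real n * real L)"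
        using kL' by (simp add: abs_divide)
      also have "\<dots> \<le> real L / (real n * real L)"
        using kL' by (intro divide_right_mono) auto
      finally have "\<bar>(real k * real L - real n) / (real n * real L)\<bar> \<le> 1 / real n"
        using pos by simp
      then show "\<bar>e * ((real k * real L - real n) / (real n * real L))\<bar> \<le> \<bar>e\<bar> * (1 / real n)"
        by (simp only: abs_mult mult_left_mono abs_ge_zero)
    qed
    also have "\<dots> = C * (real k / real n) + (B + \<bar>e\<bar>) / real n"
      by (simp add: add_divide_distrib)
    also have "\<dots> \<le> C * (1 / sqrt (real L)) + \<epsilon>"
    proof (intro add_mono mult_left_mono)
      have "real k / real n \<le> 1 / real L" using kL' pos by (simp add: field_simps)
      \<comment> \<open>The rate 1 / L is weakened to 1 / sqrt L to fit the criterion shared with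
        the standard deviations.\<close>
      also have "\<dots> \<le> 1 / sqrt (real L)"
        using L by (intro divide_left_mono real_le_lsqrt) (auto simp: power2_eq_square)
      finally show "real k / real n \<le> 1 / sqrt (real L)" .
    qed (use C_nonneg elim in auto)
    finally show ?case by (simp add: e_def)
  qed
qed

text \<open>For fixed L the blocks are i.i.d., so the classical central limit theorem applies,
  provided that their variance is positive. Otherwise the centered sums are almost surely 0 and the
  limit is 1.\<close>

lemma char_normalized_blocks:
  "(\<lambda>k. char (distr Q borel (normalized_blocks L k)) t)
    \<longlonglongrightarrow> of_real (exp (- (t * (std_dev (W 0 L) / sqrt (real L)))\<^sup>2 / 2))"
proof (cases "std_dev (W 0 L) = 0")
  case True
  have E: "expectation (normalized_blocks L k) = expectation (\<lambda>_. 0)" for k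
    by (simp add: normalized_blocks_def block_sum_def expectation_W[of "_ * L"] prob_space)
  have "std_dev (\<lambda>x. normalized_blocks L k x - 0) = 0" for k
    using True std_dev_normalized_blocks[of k L]
    by (cases "k = 0") (simp_all add: normalized_blocks_def)
  \<comment> \<open>The bound on the distance to the constant 0 is |t| times a standard deviation
    that vanishes.\<close>
  then have "char (distr Q borel (normalized_blocks L k)) t = char (distr Q borel (\<lambda>_. 0)) t" for k
    using norm_char_diff_le[OF normalized_blocks_L2 L2_const E, of _ t] by simp
  moreover have "char (distr Q borel (\<lambda>_. 0)) t = 1"
    by (simp add: char_def integral_return)
  ultimately show ?thesis using True by simp
next
  case False
  define s where "s = std_dev (W 0 L)"
  have s: "s > 0" using False std_dev_nonneg[of "W 0 L"] unfolding s_def by linarith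
  let ?S = "\<lambda>k x. (\<Sum>i<k. W (i * L) L x - expectation (W 0 L)) / sqrt (real k * s\<^sup>2)"
  have "weak_conv_m (\<lambda>k. distr Q borel (?S k)) std_normal_distribution"
    using s
    by (intro central_limit_theorem[where \<mu> = "distr Q borel (W 0 L)"] indep_vars_blocks)
       (auto simp: L2_integrable_square W_L2 expectation_W[of "_ * L"] variance_W[of "_ * L", simplified expectation_W[of "_ * L"]]
          std_dev_square s_def intro: W_distr)
  \<comment> \<open>The theorem normalizes to variance 1; evaluating at t s / sqrt L undoes this
    scaling.\<close>
  then have "(\<lambda>k. char (distr Q borel (?S k)) (t * (s / sqrt (real L)))) \<longlonglongrightarrow> char std_normal_distribution (t * (s / sqrt (real L)))"
    by (intro levy_continuity1) (auto intro: real_dist_normal_dist)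
  moreover have "char (distr Q borel (?S k)) (t * (s / sqrt (real L))) = char (distr Q borel (normalized_blocks L k)) t" for k
  proof -
    have [measurable]: "normalized_blocks L k \<in> borel_measurable Q"
      by (rule L2_measurable[OF normalized_blocks_L2])
    have "t * (s / sqrt (real L)) * ?S k x = t * normalized_blocks L k x" for x
      using s by (simp add: normalized_blocks_def block_sum_def sum_subtractf real_sqrt_mult)
    then show ?thesis
      unfolding char_def by (subst (1 2) integral_distr) (simp_all flip: of_real_mult)
  qed
  ultimately show ?thesis
    by (simp add: char_std_normal_distribution s_def)
qed

theorem central_limit:
  assumes \<sigma>: "(\<lambda>n. std_dev (W 0 n) / sqrt (real n)) \<longlonglongrightarrow> \<sigma>"
  shows "weak_conv_m (\<lambda>n. distr Q borel (normalized n)) (normal_law 0 \<sigma>)"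
proof (rule levy_continuity)
  have "0 \<le> \<sigma>" by (rule LIMSEQ_le_const[OF \<sigma>]) auto
  then show "real_distribution (normal_law 0 \<sigma>)" by (rule normal_law_real_distribution)
  show "real_distribution (distr Q borel (normalized n))" for n
    by (intro real_distribution_distr L2_measurable normalized_L2)
  fix t
  let ?u = "\<lambda>L. std_dev (W 0 L) / sqrt (real L)"
  let ?g = "\<lambda>s. of_real (exp (- (t * s)\<^sup>2 / 2)) :: complex"
  let ?c = "\<lambda>n. char (distr Q borel (normalized n)) t"
  let ?b = "\<lambda>L k. char (distr Q borel (normalized_blocks L k)) t"
  have "?c \<longlonglongrightarrow> ?g \<sigma>"
  proof (rule LIMSEQ_I)
    \<comment> \<open>The distance is split at \<open>?b L (n div L)\<close> and at
      \<open>?g (?u L)\<close>, with allowances e/2, e/4 and e/4. L is chosen before n, so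
      convergence of the block sums is needed for this L only.\<close>
    fix e :: real assume e: "0 < e"
    have "(\<lambda>L. \<bar>t\<bar> * (11 * C / sqrt (real L))) \<longlonglongrightarrow> \<bar>t\<bar> * 0"
      by (intro tendsto_mult tendsto_const tendsto_divide_0[OF tendsto_const] filterlim_at_top_imp_at_infinity
          filterlim_compose[OF sqrt_at_top] filterlim_real_sequentially)
    then have "\<forall>\<^sub>F L in sequentially. \<bar>t\<bar> * (11 * C / sqrt (real L)) < e / 4"
      using e by (intro order_tendstoD) auto
    moreover have "(\<lambda>L. ?g (?u L)) \<longlonglongrightarrow> ?g \<sigma>"
      by (intro tendsto_intros \<sigma>) auto
    then have "\<forall>\<^sub>F L in sequentially. dist (?g (?u L)) (?g \<sigma>) < e / 4"
      using e by (intro tendstoD) auto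
    ultimately have "\<forall>\<^sub>F L in sequentially. \<bar>t\<bar> * (11 * C / sqrt (real L)) < e / 4
        \<and> dist (?g (?u L)) (?g \<sigma>) < e / 4 \<and> 1 \<le> L"
      using eventually_ge_at_top[of 1] by eventually_elim auto
    then obtain L where L: "\<bar>t\<bar> * (11 * C / sqrt (real L)) < e / 4" "dist (?g (?u L)) (?g \<sigma>) < e / 4" "1 \<le> L"
      using eventually_happens trivial_limit_sequentially by blast
    \<comment> \<open>The 1 added to |t| keeps the quotient meaningful at t = 0.\<close>
    define \<delta> where "\<delta> = e / (4 * (\<bar>t\<bar> + 1))"
    have \<delta>: "0 < \<delta>" "\<bar>t\<bar> * \<delta> \<le> e / 4"
      using e by (auto simp: \<delta>_def field_simps)
    have "filterlim (\<lambda>n. n div L) at_top sequentially"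
      using L(3) by (intro filterlim_at_top_div_const_nat) simp
    then have "(\<lambda>n. ?b L (n div L)) \<longlonglongrightarrow> ?g (?u L)"
      by (rule filterlim_compose[OF char_normalized_blocks])
    then have "\<forall>\<^sub>F n in sequentially. dist (?b L (n div L)) (?g (?u L)) < e / 4"
      using e by (intro tendstoD) auto
    moreover note eventually_std_dev_normalized_diff_le[OF L(3) \<delta>(1)]
    ultimately have "\<forall>\<^sub>F n in sequentially. norm (?c n - ?g \<sigma>) < e"
    proof eventually_elim
      case (elim n)
      have E: "expectation (normalized n) = expectation (normalized_blocks L (n div L))"
        by (simp add: normalized_def normalized_blocks_def block_sum_def expectation_W[of "_ * L"] prob_space)
      have "norm (?c n - ?b L (n div L))
          \<le> \<bar>t\<bar> * std_dev (\<lambda>x. normalized n x - normalized_blocks L (n div L) x)"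
        by (rule norm_char_diff_le[OF normalized_L2 normalized_blocks_L2 E])
      also have "\<dots> \<le> \<bar>t\<bar> * (11 * C / sqrt (real L) + \<delta>)"
        by (intro mult_left_mono elim) auto
      also have "\<dots> < e / 2"
        using L(1) \<delta>(2) unfolding distrib_left by linarith
      finally have "dist (?c n) (?b L (n div L)) < e / 2" by (simp add: dist_norm)
      then show ?case
        using elim(1) L(2) dist_triangle[of "?c n" "?g \<sigma>" "?b L (n div L)"]
          dist_triangle[of "?b L (n div L)" "?g \<sigma>" "?g (?u L)"]
        unfolding dist_norm[of "?c n" "?g \<sigma>", symmetric] by linarith
    qed
    then show "\<exists>n0. \<forall>n\<ge>n0. norm (?c n - ?g \<sigma>) < e"
      by (simp only: eventually_sequentially)
  qed
  then show "?c \<longlonglongrightarrow> char (normal_law 0 \<sigma>) t"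
    by (simp add: char_normal_law \<open>0 \<le> \<sigma>\<close>)
qed

end

section \<open>The weak law of large numbers\<close>

lemma (in almost_additive) converges_in_probability:
  assumes "(\<lambda>n. expectation (W 0 n) / real n) \<longlonglongrightarrow> m"
  shows "converges_in_probability_const (\<lambda>_. Q) (\<lambda>n x. W 0 n x / real n) m"
  unfolding converges_in_probability_const_def
proof (intro allI impI)
  fix \<epsilon> :: real assume \<epsilon>: "0 < \<epsilon>"
  obtain \<sigma> where \<sigma>: "(\<lambda>n. std_dev (W 0 n) / sqrt (real n)) \<longlonglongrightarrow> \<sigma>"
    using convergent_std_dev by (auto simp: convergent_def)
  \<comment> \<open>The Chebyshev bound, with the variance of \<open>W 0 n x / real n\<close>
    written as a convergent sequence times 1 / n.\<close>
  have lim: "(\<lambda>n. (std_dev (W 0 n) / sqrt (real n))\<^sup>2 * (1 / real n) / (\<epsilon> / 2)\<^sup>2) \<longlonglongrightarrow> \<sigma>\<^sup>2 * 0 / (\<epsilon> / 2)\<^sup>2"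
    using \<epsilon> by (intro tendsto_intros \<sigma> tendsto_divide_0[OF tendsto_const]
        filterlim_at_top_imp_at_infinity filterlim_real_sequentially) auto
  have "\<forall>\<^sub>F n in sequentially. \<bar>expectation (W 0 n) / real n - m\<bar> < \<epsilon> / 2"
    using tendstoD[OF assms, of "\<epsilon> / 2"] \<epsilon> by (simp add: dist_real_def)
  then have bound: "\<forall>\<^sub>F n in sequentially. prob {x \<in> space Q. \<epsilon> < \<bar>W 0 n x / real n - m\<bar>}
      \<le> (std_dev (W 0 n) / sqrt (real n))\<^sup>2 * (1 / real n) / (\<epsilon> / 2)\<^sup>2"
    using eventually_gt_at_top[of 0]
  proof eventually_elim
    case (elim n)
    have L2: "(\<lambda>x. W 0 n x / real n) \<in> L2" by (intro L2_intros W_L2)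
    have "prob {x \<in> space Q. \<epsilon> < \<bar>W 0 n x / real n - m\<bar>}
      \<le> prob {x \<in> space Q. \<epsilon> / 2 \<le> \<bar>W 0 n x / real n - expectation (\<lambda>x. W 0 n x / real n)\<bar>}"
    proof (rule finite_measure_mono)
      show "{x \<in> space Q. \<epsilon> < \<bar>W 0 n x / real n - m\<bar>}
          \<subseteq> {x \<in> space Q. \<epsilon> / 2 \<le> \<bar>W 0 n x / real n - expectation (\<lambda>x. W 0 n x / real n)\<bar>}"
      proof safe
        fix x assume "\<epsilon> < \<bar>W 0 n x / real n - m\<bar>"
        \<comment> \<open>The mean accounts for less than half of the deviation from m, which leaves
          the other half to Chebyshev's inequality.\<close>
        then have "\<epsilon> / 2 \<le> \<bar>W 0 n x / real n - expectation (W 0 n) / real n\<bar>"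
          using elim(1) by linarith
        then show "\<epsilon> / 2 \<le> \<bar>W 0 n x / real n - expectation (\<lambda>x. W 0 n x / real n)\<bar>"
          by simp
      qed
    qed measurable
    also have "\<dots> \<le> variance (\<lambda>x. W 0 n x / real n) / (\<epsilon> / 2)\<^sup>2"
      using \<epsilon> L2 by (intro Chebyshev_inequality) (auto simp: L2_def)
    also have "variance (\<lambda>x. W 0 n x / real n) = (std_dev (W 0 n) / real n)\<^sup>2"
      unfolding std_dev_square[symmetric] std_dev_divide[OF W_L2] by simp
    also have "\<dots> = (std_dev (W 0 n) / sqrt (real n))\<^sup>2 * (1 / real n)"
      using elim by (simp add: power_divide) (simp add: power2_eq_square)
    finally show ?case .
  qed
  show "(\<lambda>n. prob {x \<in> space Q. \<epsilon> < \<bar>W 0 n x / real n - m\<bar>}) \<longlonglongrightarrow> 0"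
  proof (rule tendsto_sandwich[OF _ bound tendsto_const])
    show "(\<lambda>n. (std_dev (W 0 n) / sqrt (real n))\<^sup>2 * (1 / real n) / (\<epsilon> / 2)\<^sup>2) \<longlonglongrightarrow> 0"
      using lim by (simp only: mult_zero_right div_0)
  qed (simp_all only: measure_nonneg eventually_True)
qed

section \<open>Ground state energies\<close>

lemma finite_matchings: "finite E \<Longrightarrow> finite (matchings E)"
  by (rule finite_subset[of _ "Pow E"]) (auto simp: matchings_def)

lemma empty_in_matchings: "{} \<in> matchings E"
  by (simp add: matchings_def)

lemma hamiltonian_le_ground_state_energy:
  "finite E \<Longrightarrow> m \<in> matchings E \<Longrightarrow> hamiltonian V \<nu> \<omega> m \<le> ground_state_energy V E \<nu> \<omega>"
  unfolding ground_state_energy_def by (intro Max_ge finite_imageI finite_matchings) auto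

lemma ground_state_energy_attained:
  assumes "finite E"
  obtains m where "m \<in> matchings E" "ground_state_energy V E \<nu> \<omega> = hamiltonian V \<nu> \<omega> m"
proof -
  have "ground_state_energy V E \<nu> \<omega> \<in> hamiltonian V \<nu> \<omega> ` matchings E"
    unfolding ground_state_energy_def
    using finite_matchings[OF assms] empty_in_matchings[of E] by (intro Max_in) auto
  then show ?thesis using that by blast
qed

lemma abs_ground_state_energy_le:
  assumes "finite V" "finite E"
  shows "\<bar>ground_state_energy V E \<nu> \<omega>\<bar> \<le> (\<Sum>v\<in>V. \<bar>\<nu> v\<bar>) + (\<Sum>e\<in>E. \<bar>\<omega> e\<bar>)"
proof -
  obtain m where m: "m \<in> matchings E" "ground_state_energy V E \<nu> \<omega> = hamiltonian V \<nu> \<omega> m"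
    using ground_state_energy_attained[OF assms(2)] by blast
  have "\<bar>hamiltonian V \<nu> \<omega> m\<bar> \<le> (\<Sum>v\<in>V - \<Union>m. \<bar>\<nu> v\<bar>) + (\<Sum>e\<in>m. \<bar>\<omega> e\<bar>)"
    unfolding hamiltonian_def by (intro order_trans[OF abs_triangle_ineq] add_mono sum_abs)
  also have "\<dots> \<le> (\<Sum>v\<in>V. \<bar>\<nu> v\<bar>) + (\<Sum>e\<in>E. \<bar>\<omega> e\<bar>)"
    using m(1) assms by (intro add_mono sum_mono2) (auto simp: matchings_def)
  finally show ?thesis using m(2) by simp
qed

lemma ground_state_energy_cong:
  assumes "\<And>v. v \<in> V \<Longrightarrow> \<nu> v = \<nu>' v" "\<And>e. e \<in> E \<Longrightarrow> \<omega> e = \<omega>' e"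
  shows "ground_state_energy V E \<nu> \<omega> = ground_state_energy V E \<nu>' \<omega>'"
proof -
  have "hamiltonian V \<nu> \<omega> m = hamiltonian V \<nu>' \<omega>' m" if "m \<in> matchings E" for m
    unfolding hamiltonian_def using that assms
    by (intro arg_cong2[where f = "(+)"] sum.cong) (auto simp: matchings_def)
  then show ?thesis
    unfolding ground_state_energy_def by (intro arg_cong[where f = Max] image_cong) auto
qed

lemma borel_measurable_ground_state_energy:
  fixes \<nu> :: "'v \<Rightarrow> 'a \<Rightarrow> real"
  assumes "finite E" "\<And>v. v \<in> V \<Longrightarrow> \<nu> v \<in> borel_measurable M"
    "\<And>e. e \<in> E \<Longrightarrow> \<omega> e \<in> borel_measurable M"
  shows "(\<lambda>x. ground_state_energy V E (\<lambda>v. \<nu> v x) (\<lambda>e. \<omega> e x)) \<in> borel_measurable M"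
  unfolding ground_state_energy_def hamiltonian_def using assms(2,3)
  by (intro borel_measurable_Max finite_matchings borel_measurable_add borel_measurable_sum assms(1))
     (auto simp: matchings_def)

lemma matchings_image:
  assumes "inj f"
  shows "matchings ((`) f ` E) = (`) ((`) f) ` matchings E"
proof -
  have *: "pairwise disjnt ((`) f ` m) \<longleftrightarrow> pairwise disjnt m" for m
    using assms by (auto simp: pairwise_image pairwise_def disjnt_def inj_image_eq_iff simp flip: image_Int)
  show ?thesis
  proof (intro subset_antisym subsetI)
    fix m assume "m \<in> matchings ((`) f ` E)"
    then show "m \<in> (`) ((`) f) ` matchings E"
      using * by (auto simp: matchings_def subset_image_iff)
  next
    fix m assume "m \<in> (`) ((`) f) ` matchings E"
    then show "m \<in> matchings ((`) f ` E)"
      using * by (auto simp: matchings_def)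
  qed
qed

text \<open>The energy is invariant under injective relabelling, since \<open>f\<close> carries
  matchings to matchings bijectively. Column shifts are the intended \<open>f\<close>.\<close>

lemma ground_state_energy_image:
  assumes f: "inj f"
  shows "ground_state_energy (f ` V) ((`) f ` E) \<nu> \<omega>
    = ground_state_energy V E (\<lambda>v. \<nu> (f v)) (\<lambda>e. \<omega> (f ` e))"
proof -
  have "hamiltonian (f ` V) \<nu> \<omega> ((`) f ` m) = hamiltonian V (\<lambda>v. \<nu> (f v)) (\<lambda>e. \<omega> (f ` e)) m" for m
  proof -
    have "f ` V - \<Union> ((`) f ` m) = f ` (V - \<Union> m)"
      using image_set_diff[OF f, of V "\<Union> m"] by (simp add: image_Union)
    moreover have "inj_on ((`) f) m"
      using f by (simp add: inj_on_def inj_image_eq_iff)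
    ultimately show ?thesis
      using inj_on_subset[OF f, of "V - \<Union> m"] by (simp add: hamiltonian_def sum.reindex)
  qed
  then show ?thesis
    by (simp add: ground_state_energy_def matchings_image[OF f] image_image)
qed

section \<open>Effect of a cut on the ground state energy\<close>

text \<open>Optimal matchings of the two parts unite to a competitor for the whole graph.\<close>

lemma ground_state_energy_ge_parts:
  assumes fin: "finite V1" "finite V2" "finite E"
    and V: "V1 \<inter> V2 = {}"
    and E: "E1 \<subseteq> E" "E2 \<subseteq> E" "\<And>e. e \<in> E1 \<Longrightarrow> e \<subseteq> V1 \<and> e \<noteq> {}" "\<And>e. e \<in> E2 \<Longrightarrow> e \<subseteq> V2"
  shows "ground_state_energy V1 E1 \<nu> \<omega> + ground_state_energy V2 E2 \<nu> \<omega>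
    \<le> ground_state_energy (V1 \<union> V2) E \<nu> \<omega>"
proof -
  obtain m1 where m1: "m1 \<in> matchings E1" "ground_state_energy V1 E1 \<nu> \<omega> = hamiltonian V1 \<nu> \<omega> m1"
    using ground_state_energy_attained finite_subset[OF E(1) fin(3)] by blast
  obtain m2 where m2: "m2 \<in> matchings E2" "ground_state_energy V2 E2 \<nu> \<omega> = hamiltonian V2 \<nu> \<omega> m2"
    using ground_state_energy_attained finite_subset[OF E(2) fin(3)] by blast
  have subE: "m1 \<subseteq> E1" "m2 \<subseteq> E2"
    using m1(1) m2(1) by (auto simp: matchings_def)
  \<comment> \<open>Nonemptiness matters here: an empty edge could lie in both matchings and would
    be counted only once in their union.\<close>
  then have sub: "\<Union>m1 \<subseteq> V1" "\<Union>m2 \<subseteq> V2" and m12: "m1 \<inter> m2 = {}"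
    using E(3,4) V by blast+
  have finm: "finite m1" "finite m2"
    using subE E(1,2) fin(3) by (meson finite_subset)+
  have "disjnt e f" if "e \<in> m1" "f \<in> m2" for e f
    using sub V that unfolding disjnt_def by blast
  then have cross: "e \<in> m1 \<Longrightarrow> f \<in> m2 \<Longrightarrow> disjnt e f" "e \<in> m2 \<Longrightarrow> f \<in> m1 \<Longrightarrow> disjnt e f" for e f
    by (auto simp: disjnt_sym)
  have pw: "pairwise disjnt m1" "pairwise disjnt m2"
    using m1(1) m2(1) by (auto simp: matchings_def)
  have "pairwise disjnt (m1 \<union> m2)"
    by (rule pairwiseI) (use cross pw in \<open>auto dest: pairwiseD\<close>)
  then have m: "m1 \<union> m2 \<in> matchings E"
    using m1(1) m2(1) E by (auto simp: matchings_def)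
  have "V1 \<union> V2 - \<Union>(m1 \<union> m2) = (V1 - \<Union>m1) \<union> (V2 - \<Union>m2)"
    using sub V by blast
  moreover have "(\<Sum>v\<in>(V1 - \<Union>m1) \<union> (V2 - \<Union>m2). \<nu> v) = (\<Sum>v\<in>V1 - \<Union>m1. \<nu> v) + (\<Sum>v\<in>V2 - \<Union>m2. \<nu> v)"
    using fin V by (intro sum.union_disjoint) auto
  moreover have "(\<Sum>e\<in>m1 \<union> m2. \<omega> e) = (\<Sum>e\<in>m1. \<omega> e) + (\<Sum>e\<in>m2. \<omega> e)"
    using finm m12 by (rule sum.union_disjoint)
  ultimately have "hamiltonian (V1 \<union> V2) \<nu> \<omega> (m1 \<union> m2) = hamiltonian V1 \<nu> \<omega> m1 + hamiltonian V2 \<nu> \<omega> m2"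
    unfolding hamiltonian_def by simp
  then show ?thesis
    using hamiltonian_le_ground_state_energy[OF fin(3) m, of "V1 \<union> V2" \<nu> \<omega>] m1(2) m2(2) by simp
qed

text \<open>Deleting the edges in F from an optimal matching leaves competitors for both parts. The
  price is the weight of the deleted edges and of the vertices that they uncover.\<close>

lemma ground_state_energy_le_parts:
  assumes fin: "finite V1" "finite V2" "finite E1" "finite E2" "finite F" "finite (\<Union>F)"
    and V: "V1 \<inter> V2 = {}"
    and E: "E \<subseteq> E1 \<union> E2 \<union> F" "\<And>e. e \<in> E1 \<Longrightarrow> e \<subseteq> V1 \<and> e \<noteq> {}" "\<And>e. e \<in> E2 \<Longrightarrow> e \<subseteq> V2"
  shows "ground_state_energy (V1 \<union> V2) E \<nu> \<omega>
    \<le> ground_state_energy V1 E1 \<nu> \<omega> + ground_state_energy V2 E2 \<nu> \<omega>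
      + ((\<Sum>v\<in>\<Union>F. \<bar>\<nu> v\<bar>) + (\<Sum>e\<in>F. \<bar>\<omega> e\<bar>))"
proof -
  have "finite E" using fin E(1) by (meson finite_Un finite_subset)
  then obtain m where m: "m \<in> matchings E" "ground_state_energy (V1 \<union> V2) E \<nu> \<omega> = hamiltonian (V1 \<union> V2) \<nu> \<omega> m"
    using ground_state_energy_attained by blast
  define m1 m2 m3 where "m1 = m \<inter> E1" and "m2 = m \<inter> E2" and "m3 = m - E1 - E2"
  have m_eq: "m = m1 \<union> m2 \<union> m3" by (auto simp: m1_def m2_def m3_def)
  have finm: "finite m1" "finite m2" "finite m3" and m3: "m3 \<subseteq> F"
    using m(1) \<open>finite E\<close> fin E(1) unfolding m1_def m2_def m3_def matchings_def
    by (auto dest: finite_subset)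
  have disj: "m1 \<inter> m2 = {}" "(m1 \<union> m2) \<inter> m3 = {}"
    using E V unfolding m1_def m2_def m3_def by blast+
  have sub: "\<Union>m1 \<subseteq> V1" "\<Union>m2 \<subseteq> V2"
    using E unfolding m1_def m2_def by blast+
  have mat: "m1 \<in> matchings E1" "m2 \<in> matchings E2"
    using m(1) by (auto simp: matchings_def m1_def m2_def elim: pairwise_subset)
  \<comment> \<open>The vertices left uncovered once the parts are matched separately. The full
    matching covers in addition only the endpoints of \<open>m3\<close>, so the vertex sums differ
    by a sum over \<open>U \<inter> \<Union>m3\<close>.\<close>
  define U where "U = (V1 - \<Union>m1) \<union> (V2 - \<Union>m2)"
  have finU: "finite U" using fin by (simp add: U_def)
  have "V1 \<union> V2 - \<Union>m = U - \<Union>m3"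
    unfolding U_def m_eq using sub V by blast
  then have "(\<Sum>v\<in>V1 \<union> V2 - \<Union>m. \<nu> v) = (\<Sum>v\<in>U. \<nu> v) - (\<Sum>v\<in>U \<inter> \<Union>m3. \<nu> v)"
    using sum.Int_Diff[OF finU, of \<nu> "\<Union>m3"] by simp
  also have "(\<Sum>v\<in>U. \<nu> v) = (\<Sum>v\<in>V1 - \<Union>m1. \<nu> v) + (\<Sum>v\<in>V2 - \<Union>m2. \<nu> v)"
    unfolding U_def using fin V by (intro sum.union_disjoint) auto
  finally have vert: "(\<Sum>v\<in>V1 \<union> V2 - \<Union>m. \<nu> v)
    = (\<Sum>v\<in>V1 - \<Union>m1. \<nu> v) + (\<Sum>v\<in>V2 - \<Union>m2. \<nu> v) - (\<Sum>v\<in>U \<inter> \<Union>m3. \<nu> v)" .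
  have edge: "(\<Sum>e\<in>m. \<omega> e) = (\<Sum>e\<in>m1. \<omega> e) + (\<Sum>e\<in>m2. \<omega> e) + (\<Sum>e\<in>m3. \<omega> e)"
    unfolding m_eq using finm disj by (simp add: sum.union_disjoint)
  have "hamiltonian (V1 \<union> V2) \<nu> \<omega> m = hamiltonian V1 \<nu> \<omega> m1 + hamiltonian V2 \<nu> \<omega> m2
      + ((\<Sum>e\<in>m3. \<omega> e) - (\<Sum>v\<in>U \<inter> \<Union>m3. \<nu> v))"
    unfolding hamiltonian_def vert edge by simp
  also have "\<dots> \<le> ground_state_energy V1 E1 \<nu> \<omega> + ground_state_energy V2 E2 \<nu> \<omega>
      + ((\<Sum>v\<in>\<Union>F. \<bar>\<nu> v\<bar>) + (\<Sum>e\<in>F. \<bar>\<omega> e\<bar>))"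
  proof (intro add_mono hamiltonian_le_ground_state_energy fin mat)
    have "(\<Sum>e\<in>m3. \<omega> e) \<le> (\<Sum>e\<in>m3. \<bar>\<omega> e\<bar>)" by (intro sum_mono) auto
    also have "\<dots> \<le> (\<Sum>e\<in>F. \<bar>\<omega> e\<bar>)" using fin m3 by (intro sum_mono2) auto
    finally have 1: "(\<Sum>e\<in>m3. \<omega> e) \<le> (\<Sum>e\<in>F. \<bar>\<omega> e\<bar>)" .
    have "- (\<Sum>v\<in>U \<inter> \<Union>m3. \<nu> v) \<le> (\<Sum>v\<in>U \<inter> \<Union>m3. \<bar>\<nu> v\<bar>)"
      by (simp add: sum_negf[symmetric] sum_mono)
    also have "\<dots> \<le> (\<Sum>v\<in>\<Union>F. \<bar>\<nu> v\<bar>)" using fin m3 by (intro sum_mono2) auto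
    finally show "(\<Sum>e\<in>m3. \<omega> e) - (\<Sum>v\<in>U \<inter> \<Union>m3. \<nu> v) \<le> (\<Sum>v\<in>\<Union>F. \<bar>\<nu> v\<bar>) + (\<Sum>e\<in>F. \<bar>\<omega> e\<bar>)"
      using 1 by linarith
  qed
  finally show ?thesis using m(2) by simp
qed

section \<open>Slabs of the cylinder, their cuts and translations\<close>

definition slab_vertices :: "'h set \<Rightarrow> nat \<Rightarrow> nat \<Rightarrow> (nat \<times> 'h) set" where
  "slab_vertices VH a l = {a<..a + l} \<times> VH"

text \<open>The two kinds of edges are listed with the left endpoint first, so that cutting and
  shifting become case distinctions on a single column number.\<close>

definition slab_edges :: "'h set \<Rightarrow> 'h set set \<Rightarrow> nat \<Rightarrow> nat \<Rightarrow> (nat \<times> 'h) set set" where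
  "slab_edges VH EH a l =
     {{(i, j), (i + 1, j)} | i j. a < i \<and> i < a + l \<and> j \<in> VH} \<union>
     {{(i, j), (i, j')} | i j j'. a < i \<and> i \<le> a + l \<and> j \<in> VH \<and> j' \<in> VH \<and> {j, j'} \<in> EH}"

definition crossing_edges :: "'h set \<Rightarrow> nat \<Rightarrow> (nat \<times> 'h) set set" where
  "crossing_edges VH c = (\<lambda>j. {(c, j), (c + 1, j)}) ` VH"

lemma slab_edges_pathI:
  "a < i \<Longrightarrow> i < a + l \<Longrightarrow> j \<in> VH \<Longrightarrow> {(i, j), (i + 1, j)} \<in> slab_edges VH EH a l"
  unfolding slab_edges_def by blast

lemma slab_edges_fibreI:
  "a < i \<Longrightarrow> i \<le> a + l \<Longrightarrow> j \<in> VH \<Longrightarrow> j' \<in> VH \<Longrightarrow> {j, j'} \<in> EH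
    \<Longrightarrow> {(i, j), (i, j')} \<in> slab_edges VH EH a l"
  unfolding slab_edges_def by blast

lemma slab_edgesE:
  assumes "e \<in> slab_edges VH EH a l"
  obtains (path) i j where "a < i" "i < a + l" "j \<in> VH" "e = {(i, j), (i + 1, j)}"
    | (fibre) i j j' where "a < i" "i \<le> a + l" "j \<in> VH" "j' \<in> VH" "{j, j'} \<in> EH" "e = {(i, j), (i, j')}"
  using assms unfolding slab_edges_def by blast

lemma cylinder_vertices_eq_slab: "cylinder_vertices VH n = slab_vertices VH 0 n"
  by (auto simp: cylinder_vertices_def slab_vertices_def path_vertices_def)

lemma cylinder_edges_eq_slab: "cylinder_edges VH EH n = slab_edges VH EH 0 n"
proof (intro subset_antisym subsetI)
  fix e assume "e \<in> cylinder_edges VH EH n"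
  then obtain i j i' j' where e: "e = {(i, j), (i', j')}" "i \<in> {1..n}" "i' \<in> {1..n}" "j \<in> VH" "j' \<in> VH"
    and adj: "{i, i'} \<in> path_edges n \<and> j = j' \<or> i = i' \<and> {j, j'} \<in> EH"
    unfolding cylinder_edges_def cartesian_edges_def path_vertices_def by blast
  from adj show "e \<in> slab_edges VH EH 0 n"
  proof
    assume *: "{i, i'} \<in> path_edges n \<and> j = j'"
    then obtain k where k: "{i, i'} = {k, k + 1}" "1 \<le> k" "k < n"
      unfolding path_edges_def by blast
    \<comment> \<open>The pair \<open>{i, i'}\<close> is unordered; both orientations give the same
      edge.\<close>
    then have "e = {(k, j), (k + 1, j)}" using e(1) * by (auto simp: doubleton_eq_iff)
    then show ?thesis using k e(4) by (simp only:) (rule slab_edges_pathI, auto)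
  next
    assume "i = i' \<and> {j, j'} \<in> EH"
    then show ?thesis using e by (auto intro: slab_edges_fibreI)
  qed
next
  have cylI: "{(i, j), (i', j')} \<in> cylinder_edges VH EH n"
    if "i \<in> {1..n}" "i' \<in> {1..n}" "j \<in> VH" "j' \<in> VH" "{i, i'} \<in> path_edges n \<and> j = j' \<or> i = i' \<and> {j, j'} \<in> EH"
    for i i' j j'
    unfolding cylinder_edges_def cartesian_edges_def path_vertices_def
    using that by (intro CollectI exI[of _ i] exI[of _ j] exI[of _ i'] exI[of _ j'] conjI refl)
  fix e assume "e \<in> slab_edges VH EH 0 n"
  then show "e \<in> cylinder_edges VH EH n"
  proof (cases rule: slab_edgesE)
    case (path i j)
    have "{i, i + 1} \<in> path_edges n"
      unfolding path_edges_def using path by (intro CollectI exI[of _ i] conjI) auto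
    then show ?thesis unfolding path(4) using path by (intro cylI) auto
  next
    case (fibre i j j')
    then show ?thesis unfolding fibre(6) by (intro cylI) auto
  qed
qed

lemma finite_slab_vertices: "finite VH \<Longrightarrow> finite (slab_vertices VH a l)"
  by (simp add: slab_vertices_def)

lemma slab_edges_subset_vertices: "e \<in> slab_edges VH EH a l \<Longrightarrow> e \<subseteq> slab_vertices VH a l \<and> e \<noteq> {}"
  by (elim slab_edgesE) (auto simp: slab_vertices_def)

lemma finite_slab_edges:
  assumes "finite VH"
  shows "finite (slab_edges VH EH a l)"
proof (rule finite_subset)
  show "slab_edges VH EH a l \<subseteq> Pow (slab_vertices VH a l)"
    using slab_edges_subset_vertices by blast
  show "finite (Pow (slab_vertices VH a l))"
    using finite_slab_vertices[OF assms] by blast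
qed

lemma slab_vertices_add: "slab_vertices VH a (k + l) = slab_vertices VH a k \<union> slab_vertices VH (a + k) l"
  by (auto simp: slab_vertices_def)

lemma slab_vertices_disjoint: "slab_vertices VH a k \<inter> slab_vertices VH (a + k) l = {}"
  by (auto simp: slab_vertices_def)

lemma slab_edges_mono:
  assumes "b \<le> a" "a + k \<le> b + l"
  shows "slab_edges VH EH a k \<subseteq> slab_edges VH EH b l"
proof
  fix e assume "e \<in> slab_edges VH EH a k"
  then show "e \<in> slab_edges VH EH b l"
  proof (cases rule: slab_edgesE)
    case (path i j)
    then show ?thesis using assms unfolding path(4) by (intro slab_edges_pathI) auto
  next
    case (fibre i j j')
    then show ?thesis using assms unfolding fibre(6) by (intro slab_edges_fibreI) auto
  qed
qed

lemma slab_edges_add_subset: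
  "slab_edges VH EH a (k + l) \<subseteq> slab_edges VH EH a k \<union> slab_edges VH EH (a + k) l \<union> crossing_edges VH (a + k)"
proof
  fix e assume "e \<in> slab_edges VH EH a (k + l)"
  then show "e \<in> slab_edges VH EH a k \<union> slab_edges VH EH (a + k) l \<union> crossing_edges VH (a + k)"
  proof (cases rule: slab_edgesE)
    case (path i j)
    consider "i < a + k" | "i = a + k" | "a + k < i" by linarith
    then show ?thesis
    proof cases
      case 1
      then show ?thesis unfolding path(4) using path by (intro UnI1 slab_edges_pathI) auto
    next
      case 2
      then show ?thesis unfolding path(4) crossing_edges_def using path by blast
    next
      case 3
      then show ?thesis unfolding path(4) using path by (intro UnI1 UnI2 slab_edges_pathI) auto
    qed
  next
    case (fibre i j j')
    consider "i \<le> a + k" | "a + k < i" by linarith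
    then show ?thesis
    proof cases
      case 1
      then show ?thesis unfolding fibre(6) using fibre by (intro UnI1 slab_edges_fibreI) auto
    next
      case 2
      then show ?thesis
        unfolding fibre(6) using fibre by (intro UnI1[OF UnI2] slab_edges_fibreI) auto
    qed
  qed
qed

definition shift_column :: "nat \<Rightarrow> nat \<times> 'h \<Rightarrow> nat \<times> 'h" where
  "shift_column a v = (fst v + a, snd v)"

lemma inj_shift_column: "inj (shift_column a)"
  by (auto simp: inj_def shift_column_def prod_eq_iff)

lemma shift_column_slab_vertices: "shift_column a ` slab_vertices VH 0 l = slab_vertices VH a l"
proof (intro subset_antisym subsetI)
  fix v assume "v \<in> slab_vertices VH a l"
  \<comment> \<open>Truncated subtraction is exact here, as every column of the slab exceeds
    a.\<close>
  then have "v = shift_column a (fst v - a, snd v)" "(fst v - a, snd v) \<in> slab_vertices VH 0 l"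
    by (auto simp: slab_vertices_def shift_column_def)
  then show "v \<in> shift_column a ` slab_vertices VH 0 l" by (rule image_eqI)
qed (auto simp: slab_vertices_def shift_column_def)

lemma shift_column_slab_edges: "(`) (shift_column a) ` slab_edges VH EH 0 l = slab_edges VH EH a l"
proof (intro subset_antisym subsetI)
  fix e assume "e \<in> (`) (shift_column a) ` slab_edges VH EH 0 l"
  then obtain e' where e': "e = shift_column a ` e'" "e' \<in> slab_edges VH EH 0 l" by blast
  from e'(2) show "e \<in> slab_edges VH EH a l"
  proof (cases rule: slab_edgesE)
    case (path i j)
    then have "e = {(i + a, j), (i + a + 1, j)}" by (simp add: e'(1) shift_column_def)
    then show ?thesis using path by (simp only:) (rule slab_edges_pathI, auto)
  next
    case (fibre i j j')
    then have "e = {(i + a, j), (i + a, j')}" by (simp add: e'(1) shift_column_def)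
    then show ?thesis using fibre by (simp only:) (rule slab_edges_fibreI, auto)
  qed
next
  fix e assume "e \<in> slab_edges VH EH a l"
  then show "e \<in> (`) (shift_column a) ` slab_edges VH EH 0 l"
  proof (cases rule: slab_edgesE)
    case (path i j)
    then have "e = shift_column a ` {(i - a, j), (i - a + 1, j)}" by (simp add: shift_column_def)
    moreover have "{(i - a, j), (i - a + 1, j)} \<in> slab_edges VH EH 0 l"
      using path by (intro slab_edges_pathI) auto
    ultimately show ?thesis by (rule image_eqI)
  next
    case (fibre i j j')
    then have "e = shift_column a ` {(i - a, j), (i - a, j')}" by (simp add: shift_column_def)
    moreover have "{(i - a, j), (i - a, j')} \<in> slab_edges VH EH 0 l"
      using fibre by (intro slab_edges_fibreI) auto
    ultimately show ?thesis by (rule image_eqI)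
  qed
qed

lemma finite_crossing_edges: "finite VH \<Longrightarrow> finite (crossing_edges VH c)"
  and card_crossing_edges_le: "finite VH \<Longrightarrow> card (crossing_edges VH c) \<le> card VH"
  by (simp_all add: crossing_edges_def card_image_le)

lemma Union_crossing_edges: "\<Union>(crossing_edges VH c) = {c, c + 1} \<times> VH"
  by (auto simp: crossing_edges_def)

section \<open>Slab energies as functions of independent weights\<close>

definition weight_law :: "real measure \<Rightarrow> real measure \<Rightarrow> 'v + 'e \<Rightarrow> real measure" where
  "weight_law vertex_law edge_law = case_sum (\<lambda>_. vertex_law) (\<lambda>_. edge_law)"

text \<open>Each weight must belong to exactly one column. An edge of a slab has both ends in it,
  hence also its leftmost column. An edge crossing a cut is labelled by the column to its left, but
  neither of the two slabs at the cut reads its weight.\<close>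

definition leftmost_column :: "(nat \<times> 'h) + (nat \<times> 'h) set \<Rightarrow> nat" where
  "leftmost_column = case_sum fst (\<lambda>e. Min (fst ` e))"

definition slab_energy ::
  "'h set \<Rightarrow> 'h set set \<Rightarrow> nat \<Rightarrow> nat \<Rightarrow> ((nat \<times> 'h) + (nat \<times> 'h) set \<Rightarrow> real) \<Rightarrow> real" where
  "slab_energy VH EH a l x =
     ground_state_energy (slab_vertices VH a l) (slab_edges VH EH a l) (\<lambda>v. x (Inl v)) (\<lambda>e. x (Inr e))"

lemma slab_energy_shift:
  "slab_energy VH EH a l x = slab_energy VH EH 0 l (\<lambda>s. x (map_sum (shift_column a) ((`) (shift_column a)) s))"
  using ground_state_energy_image[OF inj_shift_column, of a "slab_vertices VH 0 l" "slab_edges VH EH 0 l"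
      "\<lambda>v. x (Inl v)" "\<lambda>e. x (Inr e)"]
  by (simp add: slab_energy_def shift_column_slab_vertices shift_column_slab_edges)

lemma leftmost_column_vertex: "v \<in> slab_vertices VH a l \<Longrightarrow> leftmost_column (Inl v) \<in> {a<..a + l}"
  by (auto simp: slab_vertices_def leftmost_column_def)

lemma leftmost_column_edge:
  assumes "e \<in> slab_edges VH EH a l"
  shows "leftmost_column (Inr e) \<in> {a<..a + l}"
  using assms by (cases rule: slab_edgesE) (auto simp: leftmost_column_def)

text \<open>Both bounds for a cut, combined. Only the crossing edges and their endpoints enter, so
  the number of weights involved does not depend on the lengths.\<close>

lemma slab_energy_additive:
  fixes x :: "(nat \<times> 'h) + (nat \<times> 'h) set \<Rightarrow> real"
  assumes "finite VH"
  defines "S \<equiv> \<lambda>c. ({c, c + 1} \<times> VH) <+> crossing_edges VH c"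
  shows "\<bar>slab_energy VH EH a (k + l) x - slab_energy VH EH a k x - slab_energy VH EH (a + k) l x\<bar>
    \<le> (\<Sum>s\<in>S (a + k). \<bar>x s\<bar>)"
proof -
  have "slab_energy VH EH a k x + slab_energy VH EH (a + k) l x \<le> slab_energy VH EH a (k + l) x"
    unfolding slab_energy_def slab_vertices_add
    by (intro ground_state_energy_ge_parts finite_slab_vertices finite_slab_edges slab_vertices_disjoint
        slab_edges_mono assms slab_edges_subset_vertices) (auto dest: slab_edges_subset_vertices)
  moreover have "slab_energy VH EH a (k + l) x \<le> slab_energy VH EH a k x + slab_energy VH EH (a + k) l x
      + ((\<Sum>v\<in>\<Union>(crossing_edges VH (a + k)). \<bar>x (Inl v)\<bar>) + (\<Sum>e\<in>crossing_edges VH (a + k). \<bar>x (Inr e)\<bar>))"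
    unfolding slab_energy_def slab_vertices_add
    by (intro ground_state_energy_le_parts finite_slab_vertices finite_slab_edges slab_vertices_disjoint
        slab_edges_add_subset finite_crossing_edges assms slab_edges_subset_vertices)
       (use assms(1) in \<open>auto simp: Union_crossing_edges dest: slab_edges_subset_vertices\<close>)
  ultimately show ?thesis
    using assms(1) by (simp add: S_def sum.Plus finite_crossing_edges Union_crossing_edges)
qed

lemma slab_energy_measurable:
  assumes "finite VH" "\<And>s. s \<in> slab_vertices VH a l <+> slab_edges VH EH a l \<Longrightarrow> (\<lambda>x. x s) \<in> borel_measurable M"
  shows "slab_energy VH EH a l \<in> borel_measurable M"
  unfolding slab_energy_def using assms
  by (intro borel_measurable_ground_state_energy finite_slab_edges) auto

text \<open>The constant: a cut involves at most 3 |V_H| weights, two columns of vertices and the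
  edges between them, and each has second moment at most the sum of the two second moments.\<close>

lemma almost_additive_slab_energy:
  fixes VH :: "'h set"
  assumes VH: "finite VH"
    and vertex: "prob_space vertex_law" "sets vertex_law = sets borel" "integrable vertex_law (\<lambda>t. t\<^sup>2)"
    and edge: "prob_space edge_law" "sets edge_law = sets borel" "integrable edge_law (\<lambda>t. t\<^sup>2)"
  shows "almost_additive (weight_law vertex_law edge_law) leftmost_column (slab_energy VH EH)
    (3 * real (card VH) * sqrt ((\<integral>t. t\<^sup>2 \<partial>vertex_law) + (\<integral>t. t\<^sup>2 \<partial>edge_law)))"
proof -
  let ?N = "weight_law vertex_law edge_law :: (nat \<times> 'h) + (nat \<times> 'h) set \<Rightarrow> real measure"
  define B where "B = (\<integral>t. t\<^sup>2 \<partial>vertex_law) + (\<integral>t. t\<^sup>2 \<partial>edge_law)"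
  interpret real_product_space ?N leftmost_column
  proof (rule real_product_space.intro)
    fix s show "prob_space (?N s)"
      using vertex edge by (cases s) (simp_all add: weight_law_def)
    show "sets (?N s) = sets borel"
      using vertex edge by (cases s) (simp_all add: weight_law_def)
  qed
  have sq: "integrable (?N s) (\<lambda>t. t\<^sup>2)" for s
    using vertex edge by (cases s) (simp_all add: weight_law_def)
  have B: "(\<integral>t. t\<^sup>2 \<partial>?N s) \<le> B" for s
    by (cases s) (simp_all add: weight_law_def B_def)
  have "0 \<le> B" by (simp add: B_def)
  have meas: "slab_energy VH EH a l \<in> borel_measurable Q" for a l
    by (intro slab_energy_measurable VH coordinate_measurable)
  have L2: "slab_energy VH EH a l \<in> L2" for a l
  proof -
    define S where "S = slab_vertices VH a l <+> slab_edges VH EH a l"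
    have "\<bar>slab_energy VH EH a l x\<bar> \<le> \<bar>\<Sum>s\<in>S. \<bar>x s\<bar>\<bar>" for x
      using abs_ground_state_energy_le[OF finite_slab_vertices[OF VH, of a l] finite_slab_edges[OF VH, of EH a l],
          of "\<lambda>v. x (Inl v)" "\<lambda>e. x (Inr e)"]
      unfolding slab_energy_def S_def
      by (subst sum.Plus) (simp_all add: finite_slab_vertices[OF VH] finite_slab_edges[OF VH])
    then show ?thesis
      by (rule L2_dominated[OF sum_abs_coordinates_L2[OF sq] meas])
  qed
  show ?thesis
  proof (intro almost_additive.intro real_product_space_axioms almost_additive_axioms.intro)
    fix a k l
    show "slab_energy VH EH a l \<in> L2"
      by (rule L2)
    show "determined_by {a<..a + l} (slab_energy VH EH a l)"
      unfolding determined_by_def slab_energy_def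
      using leftmost_column_vertex leftmost_column_edge
      by (intro allI impI ground_state_energy_cong) blast+
    show "distr Q borel (slab_energy VH EH a l) = distr Q borel (slab_energy VH EH 0 l)"
    proof -
      \<comment> \<open>Translation by a columns is an injection of the index set that preserves the
        law of every coordinate. Pulling back along it therefore preserves the product measure,
        although it is not onto for a > 0.\<close>
      define g :: "(nat \<times> 'h) + (nat \<times> 'h) set \<Rightarrow> (nat \<times> 'h) + (nat \<times> 'h) set"
        where "g = map_sum (shift_column a) ((`) (shift_column a))"
      have "inj g"
        unfolding g_def
      proof (rule sum.inj_map[OF inj_shift_column])
        show "inj ((`) (shift_column a :: nat \<times> 'h \<Rightarrow> _))"
          by (rule injI) (simp add: inj_image_eq_iff[OF inj_shift_column])
      qed
      moreover have "?N (g s) = ?N s" for s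
        by (cases s) (auto simp: g_def weight_law_def)
      ultimately have shift: "distr Q Q (\<lambda>x s. x (g s)) = Q"
        using distr_PiM_reindex[of UNIV ?N g UNIV] prob_N by (simp add: restrict_def)
      have "distr Q borel (slab_energy VH EH 0 l) = distr (distr Q Q (\<lambda>x s. x (g s))) borel (slab_energy VH EH 0 l)"
        unfolding shift ..
      also have "\<dots> = distr Q borel (slab_energy VH EH 0 l \<circ> (\<lambda>x s. x (g s)))"
      proof (rule distr_distr[OF meas])
        have "(\<lambda>x. \<lambda>s\<in>UNIV. x (g s)) \<in> measurable Q Q"
          by (rule measurable_restrict) (simp add: measurable_cong_sets[OF refl sets_N])
        then show "(\<lambda>x s. x (g s)) \<in> measurable Q Q" by (simp add: restrict_def)
      qed
      also have "slab_energy VH EH 0 l \<circ> (\<lambda>x s. x (g s)) = slab_energy VH EH a l"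
        by (simp add: fun_eq_iff g_def slab_energy_shift[of VH EH a l])
      finally show ?thesis by simp
    qed
    let ?S = "({a + k, a + k + 1} \<times> VH) <+> crossing_edges VH (a + k)"
    have "card ?S = 2 * card VH + card (crossing_edges VH (a + k))"
      using VH by (simp add: card_Plus finite_crossing_edges card_cartesian_product)
    then have card: "card ?S \<le> 3 * card VH"
      using card_crossing_edges_le[OF VH, of "a + k"] by linarith
    have "expectation (\<lambda>x. (slab_energy VH EH a (k + l) x - slab_energy VH EH a k x - slab_energy VH EH (a + k) l x)\<^sup>2)
      \<le> expectation (\<lambda>x. (\<Sum>s\<in>?S. \<bar>x s\<bar>)\<^sup>2)"
    proof (intro integral_mono L2_integrable_square L2_diff L2 sum_abs_coordinates_L2 sq)
      show "(slab_energy VH EH a (k + l) x - slab_energy VH EH a k x - slab_energy VH EH (a + k) l x)\<^sup>2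
          \<le> (\<Sum>s\<in>?S. \<bar>x s\<bar>)\<^sup>2" for x
        using slab_energy_additive[OF VH, of EH a k l x] by (intro abs_le_square_iff[THEN iffD1]) auto
    qed
    also have "\<dots> \<le> (real (card ?S))\<^sup>2 * B"
      by (rule sum_abs_coordinates_second_moment[OF sq B])
    also have "\<dots> \<le> (real (3 * card VH))\<^sup>2 * B"
      using card \<open>0 \<le> B\<close> by (intro mult_right_mono power_mono) auto
    also have "\<dots> = (3 * real (card VH) * sqrt B)\<^sup>2"
      using \<open>0 \<le> B\<close> by (simp add: power_mult_distrib)
    finally show "expectation (\<lambda>x. (slab_energy VH EH a (k + l) x - slab_energy VH EH a k x - slab_energy VH EH (a + k) l x)\<^sup>2)
      \<le> (3 * real (card VH) * sqrt ((\<integral>t. t\<^sup>2 \<partial>vertex_law) + (\<integral>t. t\<^sup>2 \<partial>edge_law)))\<^sup>2"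
      by (simp only: B_def)
  qed (simp add: \<open>0 \<le> B\<close>[unfolded B_def])
qed

section \<open>Transfer from the product space to the given probability spaces\<close>

theorem theorem1p8:
  fixes VH :: "'h set" and EH :: "'h set set"
    and P :: "nat \<Rightarrow> 'a measure"
    and \<nu> :: "nat \<Rightarrow> nat \<times> 'h \<Rightarrow> 'a \<Rightarrow> real"
    and \<omega> :: "nat \<Rightarrow> (nat \<times> 'h) set \<Rightarrow> 'a \<Rightarrow> real"
    and vertex_law edge_law :: "real measure"
    and M :: "nat \<Rightarrow> 'a \<Rightarrow> real"
  defines "M \<equiv> (\<lambda>n x. ground_state_energy (cylinder_vertices VH n) (cylinder_edges VH EH n)
                          (\<lambda>v. \<nu> n v x) (\<lambda>e. \<omega> n e x))"
  assumes graph: "finite_graph VH EH" "VH \<noteq> {}"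
    and prob: "\<And>n. n \<ge> 1 \<Longrightarrow> prob_space (P n)"
    and indep: "\<And>n. n \<ge> 1 \<Longrightarrow>
          prob_space.indep_vars (P n) (\<lambda>_. borel) (case_sum (\<nu> n) (\<omega> n))
            (cylinder_vertices VH n <+> cylinder_edges VH EH n)"
    and vertex_dist: "\<And>n v. n \<ge> 1 \<Longrightarrow> v \<in> cylinder_vertices VH n \<Longrightarrow>
          distr (P n) borel (\<nu> n v) = vertex_law"
    and edge_dist: "\<And>n e. n \<ge> 1 \<Longrightarrow> e \<in> cylinder_edges VH EH n \<Longrightarrow>
          distr (P n) borel (\<omega> n e) = edge_law"
    and second_moments: "integrable vertex_law (\<lambda>t. t\<^sup>2)" "integrable edge_law (\<lambda>t. t\<^sup>2)"
  shows "\<exists>m \<sigma>. \<sigma> \<ge> 0 \<and>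
           converges_in_probability_const P (\<lambda>n x. M n x / real n) m \<and>
           (\<lambda>n. prob_space.variance (P n) (M n) / real n) \<longlonglongrightarrow> \<sigma>\<^sup>2 \<and>
           ((\<exists>\<epsilon>>0. integrable vertex_law (\<lambda>t. \<bar>t\<bar> powr (2 + \<epsilon>)) \<and>
                    integrable edge_law (\<lambda>t. \<bar>t\<bar> powr (2 + \<epsilon>))) \<longrightarrow>
            weak_conv_m
              (\<lambda>n. distr (P n) borel
                     (\<lambda>x. (M n x - prob_space.expectation (P n) (M n)) / sqrt (real n)))
              (normal_law 0 \<sigma>))"
proof -
  have VH: "finite VH" using graph(1) by (simp add: finite_graph_def)
  obtain j where j: "j \<in> VH" using graph(2) by blast
  define I where "I n = cylinder_vertices VH n <+> cylinder_edges VH EH n" for n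
  define X where "X n = case_sum (\<nu> n) (\<omega> n)" for n
  have X_measurable: "X n s \<in> borel_measurable (P n)" if "n \<ge> 1" "s \<in> I n" for n s
  proof -
    have "\<forall>s\<in>I n. X n s \<in> borel_measurable (P n)"
      using indep[OF that(1)] unfolding X_def I_def prob_space.indep_vars_def2[OF prob[OF that(1)]]
      by (rule conjunct1)
    then show ?thesis using that(2) by (rule bspec)
  qed
  \<comment> \<open>One actual vertex and one actual edge show that the two laws are probability
    measures on the Borel sets. The edge is taken at n = 2, since a single column has no edges if H
    has none.\<close>
  define v0 where "v0 = (1 :: nat, j)"
  define e0 where "e0 = {(1 :: nat, j), (1 + 1, j)}"
  have v0: "v0 \<in> cylinder_vertices VH 1"
    using j by (simp add: v0_def cylinder_vertices_def path_vertices_def)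
  have e0: "e0 \<in> cylinder_edges VH EH 2"
    unfolding e0_def cylinder_edges_eq_slab using j by (intro slab_edges_pathI) auto
  have "vertex_law = distr (P 1) borel (X 1 (Inl v0))"
    using vertex_dist[OF _ v0] by (simp add: X_def)
  then have vertex: "prob_space vertex_law" "sets vertex_law = sets borel"
    using prob_space.prob_space_distr[OF prob X_measurable[of 1 "Inl v0"]] v0 by (auto simp: I_def)
  have "edge_law = distr (P 2) borel (X 2 (Inr e0))"
    using edge_dist[OF _ e0] by (simp add: X_def)
  then have edge: "prob_space edge_law" "sets edge_law = sets borel"
    using prob_space.prob_space_distr[OF prob X_measurable[of 2 "Inr e0"]] e0 by (auto simp: I_def)
  let ?N = "weight_law vertex_law edge_law :: (nat \<times> 'h) + (nat \<times> 'h) set \<Rightarrow> real measure"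
  let ?W = "slab_energy VH EH 0"
  interpret A: almost_additive ?N leftmost_column "slab_energy VH EH"
    "3 * real (card VH) * sqrt ((\<integral>t. t\<^sup>2 \<partial>vertex_law) + (\<integral>t. t\<^sup>2 \<partial>edge_law))"
    by (rule almost_additive_slab_energy[OF VH vertex second_moments(1) edge second_moments(2)])
  \<comment> \<open>The transfer lemma concerns functions of the restricted family. Restricting
    changes nothing, because the energy reads only coordinates in \<open>I n\<close>.\<close>
  have M_eq: "M n x = ?W n (\<lambda>s\<in>I n. X n s x)" for n x
    unfolding M_def slab_energy_def cylinder_vertices_eq_slab cylinder_edges_eq_slab
    by (intro ground_state_energy_cong)
      (auto simp: I_def X_def cylinder_vertices_eq_slab cylinder_edges_eq_slab)
  have W_restrict: "?W n (\<lambda>s\<in>I n. x s) = ?W n x" for n x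
    unfolding slab_energy_def
    by (intro ground_state_energy_cong)
      (auto simp: I_def cylinder_vertices_eq_slab cylinder_edges_eq_slab)
  have W_measurable: "?W n \<in> borel_measurable (Pi\<^sub>M (I n) (\<lambda>_. borel))" for n
    by (rule slab_energy_measurable[OF VH])
      (auto simp: I_def cylinder_vertices_eq_slab cylinder_edges_eq_slab)
  have law: "distr (P n) borel (M n) = distr A.Q borel (?W n)" if n: "n \<ge> 1" for n
  proof -
    interpret prob_space "P n" using prob n .
    have "Inl (1, j) \<in> I n"
      using j n by (auto simp: I_def cylinder_vertices_def path_vertices_def)
    then have ne: "I n \<noteq> {}" by blast
    have indepX: "indep_vars (\<lambda>_. borel) (X n) (I n)"
      using indep[OF n] by (simp add: X_def I_def)
    have lawX: "distr (P n) borel (X n s) = ?N s" if "s \<in> I n" for s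
      using that vertex_dist[OF n] edge_dist[OF n] by (auto simp: I_def X_def weight_law_def)
    show ?thesis
      using distr_indep_vars_eq_distr_PiM[OF ne indepX lawX A.prob_N A.sets_N W_measurable]
      by (simp add: M_eq[abs_def] W_restrict)
  qed
  have M_measurable: "M n \<in> borel_measurable (P n)" if "n \<ge> 1" for n
  proof -
    have "(\<lambda>x. \<lambda>s\<in>I n. X n s x) \<in> measurable (P n) (Pi\<^sub>M (I n) (\<lambda>_. borel))"
      using X_measurable[OF that] by (intro measurable_restrict)
    then show ?thesis
      unfolding M_eq[abs_def] by (rule measurable_compose[OF _ W_measurable])
  qed
  have integral_M: "(\<integral>x. f (M n x) \<partial>P n) = A.expectation (\<lambda>x. f (?W n x))"
    if "n \<ge> 1" "f \<in> borel_measurable borel" for n and f :: "real \<Rightarrow> real"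
    using integral_distr[OF M_measurable[OF that(1)] that(2)] integral_distr[OF A.W_measurable that(2), of 0 n]
    by (simp add: law[OF that(1)])
  have mean: "prob_space.expectation (P n) (M n) = A.expectation (?W n)" if "n \<ge> 1" for n
    using integral_M[OF that, of "\<lambda>t. t"] by simp
  have var: "prob_space.variance (P n) (M n) = (A.std_dev (?W n))\<^sup>2" if "n \<ge> 1" for n
    using integral_M[OF that, of "\<lambda>t. (t - A.expectation (?W n))\<^sup>2"] by (simp add: mean[OF that] A.std_dev_square)

  obtain m where m: "(\<lambda>n. A.expectation (?W n) / real n) \<longlonglongrightarrow> m"
    using A.convergent_expectation by (auto simp: convergent_def)
  obtain \<sigma> where \<sigma>: "(\<lambda>n. A.std_dev (?W n) / sqrt (real n)) \<longlonglongrightarrow> \<sigma>"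
    using A.convergent_std_dev by (auto simp: convergent_def)
  have "0 \<le> \<sigma>" by (rule LIMSEQ_le_const[OF \<sigma>]) auto
  moreover have "converges_in_probability_const P (\<lambda>n x. M n x / real n) m"
    unfolding converges_in_probability_const_def
  proof (intro allI impI)
    fix \<epsilon> :: real assume \<epsilon>: "0 < \<epsilon>"
    have *: "A.prob {x \<in> space A.Q. \<epsilon> < \<bar>?W n x / real n - m\<bar>}
      = measure (P n) {x \<in> space (P n). \<epsilon> < \<bar>M n x / real n - m\<bar>}" if "n \<ge> 1" for n
    proof -
      have S: "{t. \<epsilon> < \<bar>t / real n - m\<bar>} \<in> sets borel" by measurable
      show ?thesis
        using measure_distr[OF M_measurable[OF that] S] measure_distr[OF A.W_measurable S, of 0 n]
        by (simp add: law[OF that] vimage_def Int_def conj_commute)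
    qed
    have "\<forall>\<^sub>F n in sequentially. A.prob {x \<in> space A.Q. \<epsilon> < \<bar>?W n x / real n - m\<bar>}
      = measure (P n) {x \<in> space (P n). \<epsilon> < \<bar>M n x / real n - m\<bar>}"
      using eventually_ge_at_top[of 1] by eventually_elim (rule *)
    moreover have "(\<lambda>n. A.prob {x \<in> space A.Q. \<epsilon> < \<bar>?W n x / real n - m\<bar>}) \<longlonglongrightarrow> 0"
      using A.converges_in_probability[OF m] \<epsilon> unfolding converges_in_probability_const_def by blast
    ultimately show "(\<lambda>n. measure (P n) {x \<in> space (P n). \<epsilon> < \<bar>M n x / real n - m\<bar>}) \<longlonglongrightarrow> 0"
      by (rule Lim_transform_eventually[rotated])
  qed
  moreover have "(\<lambda>n. prob_space.variance (P n) (M n) / real n) \<longlonglongrightarrow> \<sigma>\<^sup>2"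
  proof (rule Lim_transform_eventually)
    show "(\<lambda>n. (A.std_dev (?W n) / sqrt (real n))\<^sup>2) \<longlonglongrightarrow> \<sigma>\<^sup>2"
      by (intro tendsto_power \<sigma>)
    show "\<forall>\<^sub>F n in sequentially. (A.std_dev (?W n) / sqrt (real n))\<^sup>2 = prob_space.variance (P n) (M n) / real n"
      using eventually_ge_at_top[of 1] by eventually_elim (simp only: var power_divide, simp)
  qed
  moreover have "weak_conv_m
     (\<lambda>n. distr (P n) borel (\<lambda>x. (M n x - prob_space.expectation (P n) (M n)) / sqrt (real n)))
     (normal_law 0 \<sigma>)"
  proof (rule weak_conv_m_cong[OF _ A.central_limit[OF \<sigma>]])
    fix n :: nat assume n: "1 \<le> n"
    let ?f = "\<lambda>t. (t - A.expectation (?W n)) / sqrt (real n)"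
    have "distr A.Q borel (A.normalized n) = distr (distr A.Q borel (?W n)) borel ?f"
      by (subst distr_distr) (simp_all add: A.normalized_def comp_def)
    also have "\<dots> = distr (P n) borel (\<lambda>x. ?f (M n x))"
      using M_measurable[OF n] by (subst law[OF n, symmetric], subst distr_distr) (simp_all add: comp_def)
    finally show "distr A.Q borel (A.normalized n)
      = distr (P n) borel (\<lambda>x. (M n x - prob_space.expectation (P n) (M n)) / sqrt (real n))"
      by (simp only: mean[OF n])
  qed
  ultimately show ?thesis by blast
qed

end
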